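(* Let $\mathfrak{g}$ be a Kac--Moody algebra over $\mathbb{C}$ with simple roots indexed by $I$, let $J\subset I$, let $S$ be a convex set admitting a convex embedding into a finite-dimensional real vector space, with face poset $\mathcal{F}$, and let $\mathcal{P}\to S$ be an $S$ family of Weyl polyhedra for $J$. For $F\in\mathcal{F}$, write $f_F(q)$ for the $f$-polynomial of $P(\lambda(s),J)$ for $s$ in the relative interior $S_F$ of $F$. Then the $f$-polynomial of $\mathcal{P}$ is $$f_{\mathcal{P}}(q)=\sum_{F\in\mathcal{F}}q^{\dim F}f_F(q).$$
   Context: $\mathfrak{g}$ is the Kac--Moody algebra of a generalized Cartan matrix $(a_{ij})_{i,j\in I}$ ($I$ finite) with realization $(\mathfrak{h},\{\alpha_i\},\{\check\alpha_i\})$; $W$ is the Weyl group acting on $\mathfrak{h}^*$ and $W_J=\langle s_j:j\in J\rangle$. Convexity in $\mathfrak{h}^*$ is with respect to its underlying real vector space. $D_J=\{\mu\in\mathfrak{h}^*:(\check\alpha_j,\mu)\in\mathbb{R}_{\ge0}\ \forall j\in J\}$. For $\lambda\in D_J$, $$P(\lambda,J)=\operatorname{conv}\bigcup_{w\in W_J,\ i\in I\setminus J}w(\lambda-\mathbb{R}_{\ge0}\alpha_i)$$ (meaning $\operatorname{conv}(W\lambda)$ if $J=I$). Weyl polyhedra for $J$ (finite convex combinations $\sum_it_i\operatorname{conv}V_i$, $t_i>0$, $\sum t_i=1$, of convex hulls of weights of highest weight modules $V_i$ for which $\{i\in I:f_i\text{ acts locally nilpotently on }V_i\}$ equals $J$)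 are exactly the sets $P(\lambda,J)$, $\lambda\in D_J$, and $P(\lambda,J)$ determines $\lambda$. An $S$ family of Weyl polyhedra is a subset $\mathcal{P}\subset S\times\mathfrak{h}^*$ whose fibers $F_s\subset\mathfrak{h}^*$ over $s\in S$ are all Weyl polyhedra and satisfy $tF_{s_0}+(1-t)F_{s_1}=F_{ts_0+(1-t)s_1}$ for $s_0,s_1\in S$, $0\le t\le1$. Write $F_s=P(\lambda(s),J)$, $\lambda(s)\in D_J$. The fibers over $s\in S_F$ all have the same $f$-polynomial. A face of a convex set $C$ is a (nonempty) convex subset $F\subset C$ such that whenever a convex combination $\sum_it_ic_i$ (all $t_i>0$) of points of $C$ lies in $F$, all $c_i\in F$; its dimension is that of its affine hull. The $f$-polynomial of $C$ is $\sum_{i\ge0}f_iq^i$, where $f_i\in\mathbb{Z}_{\ge0}\cup\{\infty\}$ is the number of $i$-dimensional faces of $C$. *)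

theory Defs
  imports "HOL-Analysis.Analysis" "HOL-Computational_Algebra.Polynomial"
begin

section \<open>Kac--Moody algebras\<close>

text \<open>
  The finite index set \<open>I\<close> is the type \<^typ>\<open>'i\<close>. A basis of the Cartan subalgebra is fixed,
  so that both \<open>\<hh>\<close> and its complex dual are \<^typ>\<open>complex ^ 'n\<close>, with the complex bilinear
  evaluation pairing \<^const>\<open>scalar_product\<close> (first argument in \<open>\<hh>\<close>, second in the dual).
  The library structure on \<^typ>\<open>complex ^ 'n\<close> as a real vector space is the underlying real structure,
  while \<open>(*s)\<close> is the complex scaling.
\<close>

record ('g, 'n::finite, 'i::finite) kac_moody_data =
  gcm :: "int ^ 'i ^ 'i"
  root :: "'i \<Rightarrow> complex ^ 'n"
  coroot :: "'i \<Rightarrow> complex ^ 'n"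
  lscale :: "complex \<Rightarrow> 'g \<Rightarrow> 'g"
  bracket :: "'g \<Rightarrow> 'g \<Rightarrow> 'g"
  cartan :: "complex ^ 'n \<Rightarrow> 'g"
  chev_e :: "'i \<Rightarrow> 'g"
  chev_f :: "'i \<Rightarrow> 'g"

definition generalized_cartan_matrix :: "int ^ 'i ^ 'i::finite \<Rightarrow> bool" where
  "generalized_cartan_matrix A \<longleftrightarrow>
     (\<forall>i. A $ i $ i = 2) \<and>
     (\<forall>i j. i \<noteq> j \<longrightarrow> A $ i $ j \<le> 0) \<and>
     (\<forall>i j. A $ i $ j = 0 \<longleftrightarrow> A $ j $ i = 0)"

definition realization ::
  "int ^ 'i ^ 'i::finite \<Rightarrow> ('i \<Rightarrow> complex ^ 'n::finite) \<Rightarrow> ('i \<Rightarrow> complex ^ 'n) \<Rightarrow> bool" where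
  "realization A al ch \<longleftrightarrow>
     inj al \<and> vec.independent (range al) \<and>
     inj ch \<and> vec.independent (range ch) \<and>
     (\<forall>i j. scalar_product (ch i) (al j) = of_int (A $ i $ j)) \<and>
     CARD('n) + rank ((\<chi> i j. of_int (A $ i $ j)) :: complex ^ 'i ^ 'i) = 2 * CARD('i)"

definition lie_algebra :: "(complex \<Rightarrow> 'g \<Rightarrow> 'g) \<Rightarrow> ('g \<Rightarrow> 'g \<Rightarrow> 'g::ab_group_add) \<Rightarrow> bool" where
  "lie_algebra sc br \<longleftrightarrow>
     vector_space sc \<and>
     (\<forall>x. Vector_Spaces.linear sc sc (br x)) \<and>
     (\<forall>y. Vector_Spaces.linear sc sc (\<lambda>x. br x y)) \<and>
     (\<forall>x. br x x = 0) \<and>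
     (\<forall>x y z. br x (br y z) + br y (br z x) + br z (br x y) = 0)"

text \<open>
  A Lie algebra containing \<open>\<hh>\<close>, generated by \<open>\<hh>\<close> and the Chevalley generators, in which the
  Chevalley--Serre relations hold. Since \<^const>\<open>cartan\<close> is injective, these are exactly the
  quotients of the Lie algebra presented by the Chevalley--Serre relations by ideals meeting
  \<open>\<hh>\<close> trivially. So both usual conventions for ``the Kac--Moody algebra of \<open>A\<close>'' are covered:
  the presented algebra itself and its quotient by the largest such ideal (the two coincide when
  \<open>A\<close> is symmetrizable).
\<close>

definition kac_moody_algebra :: "('g::ab_group_add, 'n::finite, 'i::finite) kac_moody_data \<Rightarrow> bool" where
  "kac_moody_algebra G \<longleftrightarrow>
     generalized_cartan_matrix (gcm G) \<and>
     realization (gcm G) (root G) (coroot G) \<and>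
     lie_algebra (lscale G) (bracket G) \<and>
     Vector_Spaces.linear (*s) (lscale G) (cartan G) \<and> inj (cartan G) \<and>
     (\<forall>h h'. bracket G (cartan G h) (cartan G h') = 0) \<and>
     (\<forall>i j. bracket G (chev_e G i) (chev_f G j) = (if i = j then cartan G (coroot G i) else 0)) \<and>
     (\<forall>h i. bracket G (cartan G h) (chev_e G i)
              = lscale G (scalar_product h (root G i)) (chev_e G i)) \<and>
     (\<forall>h i. bracket G (cartan G h) (chev_f G i)
              = lscale G (- scalar_product h (root G i)) (chev_f G i)) \<and>
     (\<forall>i j. i \<noteq> j \<longrightarrow>
        (bracket G (chev_e G i) ^^ nat (1 - gcm G $ i $ j)) (chev_e G j) = 0 \<and>
        (bracket G (chev_f G i) ^^ nat (1 - gcm G $ i $ j)) (chev_f G j) = 0) \<and>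
     (\<forall>U. module.subspace (lscale G) U \<and> (\<forall>x\<in>U. \<forall>y\<in>U. bracket G x y \<in> U) \<and>
        range (cartan G) \<union> range (chev_e G) \<union> range (chev_f G) \<subseteq> U \<longrightarrow> U = UNIV)"

section \<open>Highest weight modules\<close>

text \<open>
  Modules are carried by complex subspaces \<open>V\<close> of an ambient complex vector space \<open>('v, sv)\<close>, so
  that finitely many modules of different sizes can occur together in one formula. The theorem
  quantifies over the ambient space; any set of modules embeds in a common one (their direct
  sum).
\<close>

definition g_module ::
  "('g::ab_group_add, 'n::finite, 'i::finite) kac_moody_data \<Rightarrow> (complex \<Rightarrow> 'v \<Rightarrow> 'v::ab_group_add) \<Rightarrow>
   'v set \<Rightarrow> ('g \<Rightarrow> 'v \<Rightarrow> 'v) \<Rightarrow> bool" where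
  "g_module G sv V act \<longleftrightarrow>
     module.subspace sv V \<and>
     (\<forall>x. \<forall>v\<in>V. act x v \<in> V) \<and>
     (\<forall>x. \<forall>u\<in>V. \<forall>v\<in>V. act x (u + v) = act x u + act x v) \<and>
     (\<forall>x c. \<forall>v\<in>V. act x (sv c v) = sv c (act x v)) \<and>
     (\<forall>x y. \<forall>v\<in>V. act (x + y) v = act x v + act y v) \<and>
     (\<forall>c x. \<forall>v\<in>V. act (lscale G c x) v = sv c (act x v)) \<and>
     (\<forall>x y. \<forall>v\<in>V. act (bracket G x y) v = act x (act y v) - act y (act x v))"

definition weight_space ::
  "('g, 'n::finite, 'i::finite) kac_moody_data \<Rightarrow> (complex \<Rightarrow> 'v \<Rightarrow> 'v) \<Rightarrow>
   'v set \<Rightarrow> ('g \<Rightarrow> 'v \<Rightarrow> 'v) \<Rightarrow> complex ^ 'n \<Rightarrow> 'v set" where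
  "weight_space G sv V act \<mu> = {v \<in> V. \<forall>h. act (cartan G h) v = sv (scalar_product h \<mu>) v}"

definition weights ::
  "('g, 'n::finite, 'i::finite) kac_moody_data \<Rightarrow> (complex \<Rightarrow> 'v \<Rightarrow> 'v::zero) \<Rightarrow>
   'v set \<Rightarrow> ('g \<Rightarrow> 'v \<Rightarrow> 'v) \<Rightarrow> (complex ^ 'n) set" where
  "weights G sv V act = {\<mu>. \<exists>v \<in> weight_space G sv V act \<mu>. v \<noteq> 0}"

definition highest_weight_module ::
  "('g::ab_group_add, 'n::finite, 'i::finite) kac_moody_data \<Rightarrow> (complex \<Rightarrow> 'v \<Rightarrow> 'v::ab_group_add) \<Rightarrow>
   'v set \<Rightarrow> ('g \<Rightarrow> 'v \<Rightarrow> 'v) \<Rightarrow> bool" where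
  "highest_weight_module G sv V act \<longleftrightarrow>
     g_module G sv V act \<and>
     (\<exists>\<Lambda>. \<exists>v \<in> weight_space G sv V act \<Lambda>. v \<noteq> 0 \<and>
        (\<forall>i. act (chev_e G i) v = 0) \<and>
        (\<forall>U\<subseteq>V. g_module G sv U act \<and> v \<in> U \<longrightarrow> U = V))"

definition integrability ::
  "('g, 'n::finite, 'i::finite) kac_moody_data \<Rightarrow> 'v set \<Rightarrow> ('g \<Rightarrow> 'v \<Rightarrow> 'v::zero) \<Rightarrow> 'i set" where
  "integrability G V act = {i. \<forall>v\<in>V. \<exists>k. (act (chev_f G i) ^^ k) v = 0}"

section \<open>Weyl polyhedra\<close>

definition weyl_polyhedron ::
  "('g::ab_group_add, 'n::finite, 'i::finite) kac_moody_data \<Rightarrow> (complex \<Rightarrow> 'v \<Rightarrow> 'v::ab_group_add) \<Rightarrow>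
   'i set \<Rightarrow> (complex ^ 'n) set \<Rightarrow> bool" where
  "weyl_polyhedron G sv J C \<longleftrightarrow>
     (\<exists>(N::nat) (t :: nat \<Rightarrow> real) V act.
        0 < N \<and> (\<forall>m<N. 0 < t m) \<and> (\<Sum>m<N. t m) = 1 \<and>
        (\<forall>m<N. highest_weight_module G sv (V m) (act m) \<and> integrability G (V m) (act m) = J) \<and>
        C = {\<Sum>m<N. t m *\<^sub>R x m | x. \<forall>m<N. x m \<in> convex hull (weights G sv (V m) (act m))})"

definition simple_reflection ::
  "('g, 'n::finite, 'i::finite) kac_moody_data \<Rightarrow> 'i \<Rightarrow> complex ^ 'n \<Rightarrow> complex ^ 'n" where
  "simple_reflection G i \<mu> = \<mu> - scalar_product (coroot G i) \<mu> *s root G i"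

text \<open>
  The parabolic subgroup \<open>W\<^sub>J\<close>, as a group of transformations of the dual of \<open>\<hh>\<close>; closure under
  inverses is automatic as simple reflections are involutions.
\<close>

inductive_set weyl_group ::
  "('g, 'n::finite, 'i::finite) kac_moody_data \<Rightarrow> 'i set \<Rightarrow> (complex ^ 'n \<Rightarrow> complex ^ 'n) set"
  for G J where
  "id \<in> weyl_group G J"
| "w \<in> weyl_group G J \<Longrightarrow> j \<in> J \<Longrightarrow> simple_reflection G j \<circ> w \<in> weyl_group G J"

definition dominant ::
  "('g, 'n::finite, 'i::finite) kac_moody_data \<Rightarrow> 'i set \<Rightarrow> (complex ^ 'n) set" where
  "dominant G J = {\<mu>. \<forall>j\<in>J. scalar_product (coroot G j) \<mu> \<in> \<real>\<^sub>\<ge>\<^sub>0}"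

definition P_polyhedron ::
  "('g, 'n::finite, 'i::finite) kac_moody_data \<Rightarrow> complex ^ 'n \<Rightarrow> 'i set \<Rightarrow> (complex ^ 'n) set" where
  "P_polyhedron G \<nu> J =
     (if J = UNIV then convex hull ((\<lambda>w. w \<nu>) ` weyl_group G J)
      else convex hull (\<Union>w\<in>weyl_group G J. \<Union>i\<in>UNIV - J. w ` {\<nu> - t *\<^sub>R root G i | t::real. 0 \<le> t}))"

definition fiber :: "('s \<times> 'a) set \<Rightarrow> 's \<Rightarrow> 'a set" where
  "fiber P s = {x. (s, x) \<in> P}"

definition weyl_family ::
  "('g::ab_group_add, 'n::finite, 'i::finite) kac_moody_data \<Rightarrow> (complex \<Rightarrow> 'v \<Rightarrow> 'v::ab_group_add) \<Rightarrow>
   'i set \<Rightarrow> 's::real_vector set \<Rightarrow> ('s \<times> (complex ^ 'n)) set \<Rightarrow> bool" where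
  "weyl_family G sv J S P \<longleftrightarrow>
     P \<subseteq> S \<times> UNIV \<and>
     (\<forall>s\<in>S. weyl_polyhedron G sv J (fiber P s)) \<and>
     (\<forall>s0\<in>S. \<forall>s1\<in>S. \<forall>t. 0 \<le> t \<and> t \<le> 1 \<longrightarrow>
        {t *\<^sub>R x + (1 - t) *\<^sub>R y | x y. x \<in> fiber P s0 \<and> y \<in> fiber P s1}
          = fiber P (t *\<^sub>R s0 + (1 - t) *\<^sub>R s1))"

section \<open>Faces and \<open>f\<close>-polynomials\<close>

definition faces :: "'a::real_vector set \<Rightarrow> 'a set set" where
  "faces C = {F. F face_of C \<and> F \<noteq> {}}"

text \<open>The library's \<^const>\<open>face_of\<close> tests two-point combinations only; this is equivalent to
  testing all finite ones.\<close>

lemma face_of_iff_finite_combinations: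
  fixes C :: "'a::real_vector set"
  assumes C: "convex C"
  shows "F face_of C \<longleftrightarrow> F \<subseteq> C \<and> convex F \<and>
    (\<forall>(K::nat set) t c. finite K \<longrightarrow> (\<forall>k\<in>K. 0 < t k \<and> c k \<in> C) \<longrightarrow> sum t K = 1 \<longrightarrow>
       (\<Sum>k\<in>K. t k *\<^sub>R c k) \<in> F \<longrightarrow> (\<forall>k\<in>K. c k \<in> F))"
    (is "_ \<longleftrightarrow> _ \<and> _ \<and> ?R")
proof (intro iffI conjI)
  assume F: "F face_of C"
  show "F \<subseteq> C" "convex F"
    using F by (auto simp: face_of_def)
  show ?R
  proof (intro allI impI ballI)
    fix K :: "nat set" and t :: "nat \<Rightarrow> real" and c k
    assume K: "finite K" and tc: "\<forall>k\<in>K. 0 < t k \<and> c k \<in> C" and s: "sum t K = 1"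
      and x: "(\<Sum>k\<in>K. t k *\<^sub>R c k) \<in> F" and k: "k \<in> K"
    define L where "L = K - {k}"
    have L: "finite L" "k \<notin> L" "K = insert k L"
      using K k by (auto simp: L_def)
    show "c k \<in> F"
    proof (cases "L = {}")
      case True
      then show ?thesis using x s L by simp
    next
      case False
      define u where "u = sum t L"
      have u: "0 < u" "t k + u = 1"
        using False tc L s by (auto simp: u_def intro!: sum_pos)
      define d where "d = (\<Sum>l\<in>L. (t l / u) *\<^sub>R c l)"
      have "sum (\<lambda>l. t l / u) L = 1"
        using u by (simp add: sum_divide_distrib[symmetric] u_def)
      then have d: "d \<in> C"
        unfolding d_def using tc L u by (intro convex_sum[OF _ C]) auto
      have ud: "u *\<^sub>R d = (\<Sum>l\<in>L. t l *\<^sub>R c l)"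
        using u by (simp add: d_def scaleR_sum_right)
      have x': "(1 - u) *\<^sub>R c k + u *\<^sub>R d \<in> F"
      proof -
        have "1 - u = t k" using u by simp
        then show ?thesis using x L by (simp add: ud)
      qed
      show ?thesis
      proof (cases "c k = d")
        case True
        then show ?thesis using x' by (simp add: scaleR_left_distrib[symmetric])
      next
        case False
        have "u < 1" using u tc k by force
        then have "(1 - u) *\<^sub>R c k + u *\<^sub>R d \<in> open_segment (c k) d"
          using False u by (auto simp: in_segment)
        then show ?thesis using face_ofD[OF F _ _ d x'] tc k by blast
      qed
    qed
  qed
next
  assume *: "F \<subseteq> C \<and> convex F \<and> ?R"
  show "F face_of C"
    unfolding face_of_def
  proof (intro conjI ballI impI)
    fix a b x assume ab: "a \<in> C" "b \<in> C" and x: "x \<in> F" "x \<in> open_segment a b"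
    obtain u where u: "0 < u" "u < 1" "x = (1 - u) *\<^sub>R a + u *\<^sub>R b"
      using x by (auto simp: in_segment)
    have "\<forall>k\<in>{0,1::nat}. (if k = 0 then a else b) \<in> F"
      using * [THEN conjunct2, THEN conjunct2, rule_format, of "{0,1}"
          "\<lambda>k. if k = 0 then 1 - u else u" "\<lambda>k. if k = 0 then a else b"] u ab x
      by auto
    then show "a \<in> F" "b \<in> F" by auto
  qed (use * in auto)
qed

definition face_dim :: "'a::euclidean_space set \<Rightarrow> nat" where
  "face_dim F = nat (aff_dim F)"

definition ecard :: "'a set \<Rightarrow> enat" where
  "ecard A = (if finite A then enat (card A) else \<infinity>)"

text \<open>No face has dimension beyond that of the ambient space, so the sum below has all terms.\<close>

definition f_poly :: "'a::euclidean_space set \<Rightarrow> enat poly" where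
  "f_poly C = (\<Sum>i\<le>DIM('a). monom (ecard {F \<in> faces C. face_dim F = i}) i)"

lemma coeff_f_poly:
  fixes C :: "'a::euclidean_space set"
  shows "coeff (f_poly C) i = ecard {F \<in> faces C. face_dim F = i}"
proof (cases "i \<le> DIM('a)")
  case True
  then show ?thesis by (simp add: f_poly_def coeff_sum if_distrib cong: if_cong)
next
  case False
  have "face_dim F \<noteq> i" for F :: "'a set"
    using False aff_dim_le_DIM[of F] by (auto simp: face_dim_def)
  then have "{F \<in> faces C. face_dim F = i} = {}"
    by blast
  then have "ecard {F \<in> faces C. face_dim F = i} = 0"
    by (simp only: ecard_def zero_enat_def finite.emptyI card.empty if_True)
  moreover have "coeff (f_poly C) i = 0"
    unfolding f_poly_def coeff_sum using False by (intro sum.neutral) auto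
  ultimately show ?thesis by simp
qed

text \<open>
  \<open>S\<close> may have infinitely many faces. A sum of polynomials over \<open>\<nat> \<union> {\<infinity>}\<close> is then understood
  coefficientwise; in \<^typ>\<open>enat\<close> every family is summable, to the supremum of the finite
  partial sums.
\<close>

lemma infsum_enat:
  fixes g :: "'a \<Rightarrow> enat"
  shows "(\<Sum>\<^sub>\<infinity>x\<in>A. g x) = (SUP K\<in>{K. finite K \<and> K \<subseteq> A}. sum g K)"
  by (rule nonneg_infsum_complete) simp

end

theory Submission
  imports Defs
begin

text \<open>
  Let \<open>\<P>\<close> be the total space of the family and \<open>H\<close> one of its faces. Since the fiber over a point between \<open>a\<close> and
  \<open>b\<close> is the corresponding combination of the fibers over \<open>a\<close> and \<open>b\<close>, the projection of \<open>H\<close> to \<open>S\<close>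
  is a face \<open>F\<close> of \<open>S\<close>. For \<open>s\<close> in the relative interior of \<open>F\<close>, slicing at \<open>s\<close> is a bijection from
  the faces of \<open>\<P>\<close> that project onto \<open>F\<close> to the faces of the fiber over \<open>s\<close>, and it lowers the
  dimension by \<open>dim F\<close> (\<open>bij_betw_faces_fiber\<close>, \<open>face_dim_fiber\<close>). Counting the faces of \<open>\<P>\<close>
  according to their projections gives the formula (\<open>coeff_f_poly_convex_family\<close>).

  It remains to write every Weyl polyhedron as \<open>P(\<lambda>, J)\<close> with \<open>\<lambda>\<close> in \<open>D\<^sub>J\<close>. Put
  \<open>X(\<lambda>) = conv (W\<^sub>J \<lambda>) - K\<close>, with \<open>K\<close> the convex cone spanned by the \<open>W\<^sub>J\<close>-orbits of the simple roots
  outside \<open>J\<close>. Three facts are needed: \<open>P(\<lambda>, J) = X(\<lambda>)\<close>; the hull of the weights of a highest weight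
  module with highest weight \<open>\<lambda>\<close> and integrability \<open>J\<close> is \<open>X(\<lambda>)\<close>; and convex combinations of sets
  \<open>X(\<lambda>)\<close> are taken in the parameter. All of them rest on one geometric observation
  (\<open>add_descents_mem\<close>): if \<open>a\<close> is dominant, and the points of the orbit of \<open>b\<close> are reached from \<open>b\<close> by
  simple reflections that go down, then \<open>a + w b\<close> lies in \<open>conv (W\<^sub>J (a + b))\<close>, because each step
  ends on the segment between a point already reached and its mirror image.

  That orbits are reached by going down is a statement about Coxeter groups, but for the weights
  concerned it follows from modules (\<open>descending_highest_weight\<close>): if \<open>b\<close> is the weight of a vector that
  is singular for \<open>J\<close> in a module integrable for \<open>J\<close>, a dominant weight in its orbit carries again
  a singular vector, and this forces it to be \<open>b\<close>. The highest weights of the given modules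
  are of this kind, and so are the negatives of the simple roots outside \<open>J\<close>, by the adjoint module.
\<close>

section \<open>Counting\<close>

lemma ecard_image: "inj_on f A \<Longrightarrow> ecard (f ` A) = ecard A"
  by (simp add: ecard_def finite_image_iff card_image)

lemma ecard_bij_betw: "bij_betw f A B \<Longrightarrow> ecard A = ecard B"
  using ecard_image by (metis bij_betw_def)

lemma ecard_mono: "A \<subseteq> B \<Longrightarrow> ecard A \<le> ecard B"
  by (auto simp: ecard_def card_mono dest: finite_subset)

lemma ecard_le_if_finite_subsets_le:
  assumes "\<And>B. finite B \<Longrightarrow> B \<subseteq> A \<Longrightarrow> enat (card B) \<le> c"
  shows "ecard A \<le> c"
proof (cases "finite A")
  case True
  then show ?thesis using assms by (simp add: ecard_def)
next
  case False
  have "enat n \<le> c" for n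
    using infinite_arbitrarily_large[OF False, of n] assms by blast
  then have "c = \<infinity>"
    by (metis Suc_ile_eq enat.exhaust enat_ord_simps(2) less_irrefl)
  then show ?thesis by simp
qed

lemma ecard_UN_disjoint_finite:
  assumes "finite K" "disjoint_family_on X K"
  shows "ecard (\<Union>k\<in>K. X k) = (\<Sum>k\<in>K. ecard (X k))"
proof (cases "\<forall>k\<in>K. finite (X k)")
  case True
  then have "ecard (\<Union>k\<in>K. X k) = enat (\<Sum>k\<in>K. card (X k))"
    using assms by (simp add: ecard_def card_UN_disjoint' disjoint_family_on_def)
  also have "\<dots> = (\<Sum>k\<in>K. ecard (X k))"
    using assms(1) True by (induction K rule: finite_induct)
      (auto simp: ecard_def zero_enat_def simp flip: plus_enat_simps(1))
  finally show ?thesis .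
next
  case False
  then obtain k where k: "k \<in> K" "infinite (X k)" by blast
  then have "infinite (\<Union>k\<in>K. X k)"
    by (meson UN_upper finite_subset)
  moreover have "(\<Sum>k\<in>K. ecard (X k)) = \<infinity>"
    using k assms(1) by (subst sum.remove[of _ k]) (auto simp: ecard_def)
  ultimately show ?thesis by (simp add: ecard_def)
qed

text \<open>
  Both sides are suprema over finite data: a finite subset of the union meets only finitely many
  of its members, and on finitely many members cardinalities add up.
\<close>

lemma ecard_UN_disjoint:
  assumes "disjoint_family_on X I"
  shows "ecard (\<Union>i\<in>I. X i) = (\<Sum>\<^sub>\<infinity>i\<in>I. ecard (X i))"
  unfolding infsum_enat
proof (rule antisym)
  let ?s = "SUP K\<in>{K. finite K \<and> K \<subseteq> I}. \<Sum>i\<in>K. ecard (X i)"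
  have fin: "ecard (\<Union>i\<in>K. X i) = (\<Sum>i\<in>K. ecard (X i))" if "finite K" "K \<subseteq> I" for K
    using that assms by (intro ecard_UN_disjoint_finite) (auto simp: disjoint_family_on_def)
  show "ecard (\<Union>i\<in>I. X i) \<le> ?s"
  proof (rule ecard_le_if_finite_subsets_le)
    fix B assume B: "finite B" "B \<subseteq> (\<Union>i\<in>I. X i)"
    then obtain K where K: "K \<subseteq> I" "finite K" "B \<subseteq> (\<Union>i\<in>K. X i)"
      using finite_subset_Union[of B "X ` I"] finite_subset_image[of _ X I]
      by (smt (verit, ccfv_threshold) UN_I Union_iff finite_subset_image imageE subset_iff)
    have "enat (card B) = ecard B" using B by (simp add: ecard_def)
    also have "\<dots> \<le> (\<Sum>i\<in>K. ecard (X i))"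
      using ecard_mono[OF K(3)] fin K by simp
    also have "\<dots> \<le> ?s" using K by (intro SUP_upper) auto
    finally show "enat (card B) \<le> ?s" .
  qed
  show "?s \<le> ecard (\<Union>i\<in>I. X i)"
    by (rule SUP_least) (auto simp flip: fin intro!: ecard_mono)
qed

section \<open>Faces of a family over a convex base\<close>

lemma aff_dim_nonneg: "S \<noteq> {} \<Longrightarrow> 0 \<le> aff_dim S"
  using aff_dim_geq[of S] aff_dim_empty[of S] by linarith

text \<open>
  A face through \<open>z\<close> of least dimension has \<open>z\<close> in its relative interior: otherwise a
  hyperplane supporting it at \<open>z\<close> would cut out a face through \<open>z\<close> of smaller dimension.
\<close>

lemma ex_face_of_rel_interior:
  fixes C :: "'a::euclidean_space set"
  assumes C: "convex C" and z: "z \<in> C"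
  obtains F where "F face_of C" "z \<in> rel_interior F"
proof -
  define Q where "Q F \<longleftrightarrow> F face_of C \<and> z \<in> F" for F
  have "Q C" using C z by (simp add: Q_def face_of_refl)
  then obtain F where F: "Q F" and min: "\<And>F'. Q F' \<Longrightarrow> nat (aff_dim F) \<le> nat (aff_dim F')"
    using ex_has_least_nat[of Q C "\<lambda>F. nat (aff_dim F)"] by blast
  have cF: "convex F" using F by (auto simp: Q_def face_of_imp_convex)
  have "z \<in> rel_interior F"
  proof (rule ccontr)
    assume n: "z \<notin> rel_interior F"
    obtain a where a: "\<And>y. y \<in> F \<Longrightarrow> a \<bullet> z \<le> a \<bullet> y" "\<And>y. y \<in> rel_interior F \<Longrightarrow> a \<bullet> z < a \<bullet> y"
      using supporting_hyperplane_rel_boundary[OF cF _ n] F unfolding Q_def by metis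
    define F' where "F' = F \<inter> {x. a \<bullet> x = a \<bullet> z}"
    have f: "F' face_of F"
      unfolding F'_def using face_of_Int_supporting_hyperplane_ge[OF cF] a(1) by blast
    have "rel_interior F \<noteq> {}" using rel_interior_eq_empty[OF cF] F by (auto simp: Q_def)
    then obtain y where y: "y \<in> rel_interior F" by blast
    then have "y \<in> F" "y \<notin> F'" using a(2)[OF y] rel_interior_subset[of F] by (auto simp: F'_def)
    then have "F' \<noteq> F" by blast
    then have lt: "aff_dim F' < aff_dim F" using face_of_aff_dim_lt[OF cF f] by simp
    have "Q F'" using face_of_trans[OF f] F by (auto simp: Q_def F'_def)
    then have "aff_dim F' \<ge> 0" by (intro aff_dim_nonneg) (auto simp: Q_def)
    then show False using min[OF \<open>Q F'\<close>] lt by linarith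
  qed
  then show thesis using that F by (auto simp: Q_def)
qed

text \<open>
  The slice over \<open>s\<close> is the intersection of \<open>C\<close> with the affine space \<open>{s} \<times> UNIV\<close>. Relative
  interiors commute with linear images, so this affine space meets the relative interior of \<open>C\<close>
  when \<open>s\<close> is in the relative interior of the projection; and then forming relative interiors and
  affine hulls commutes with intersecting.
\<close>

lemma rel_interior_fiber:
  fixes C :: "('s::euclidean_space \<times> 'a::euclidean_space) set"
  assumes C: "convex C" and s: "s \<in> rel_interior (fst ` C)"
  shows "rel_interior (fiber C s) = fiber (rel_interior C) s"
    and "affine hull (fiber C s) = fiber (affine hull C) s"
    and "fiber (rel_interior C) s \<noteq> {}"
proof -
  define L where "L = {s} \<times> (UNIV :: 'a set)"
  have L: "affine L" by (auto simp: L_def affine_def simp flip: scaleR_add_left)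
  have im: "X \<inter> L = (\<lambda>x. (s, 0) + (0, x)) ` fiber X s" for X :: "('s \<times> 'a) set"
    by (auto simp: L_def fiber_def)
  have lin: "linear (\<lambda>x::'a. (0::'s, x))" "inj (\<lambda>x::'a. (0::'s, x))"
    by (auto intro!: linearI injI)
  have blin: "bounded_linear (\<lambda>x::'a. (0::'s, x))"
    using lin(1) by (simp add: linear_conv_bounded_linear)
  have "s \<in> fst ` rel_interior C"
    using s rel_interior_convex_linear_image[OF linear_fst C] by simp
  then show ne: "fiber (rel_interior C) s \<noteq> {}" by (auto simp: fiber_def)
  then have neL: "rel_interior C \<inter> L \<noteq> {}" by (auto simp: fiber_def L_def)
  have im': "X \<inter> L = (+) (s, 0) ` ((\<lambda>x. (0, x)) ` fiber X s)" for X :: "('s \<times> 'a) set"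
    by (simp add: im image_image)
  have inj: "inj (\<lambda>x::'a. (s, 0) + (0::'s, x))" by (auto intro: injI)
  have r: "rel_interior (X \<inter> L) = (\<lambda>x. (s, 0) + (0, x)) ` rel_interior (fiber X s)"
    for X :: "('s \<times> 'a) set"
    unfolding im' rel_interior_translation rel_interior_injective_linear_image[OF blin lin(2)]
    by (simp add: image_image)
  have h: "affine hull (X \<inter> L) = (\<lambda>x. (s, 0) + (0, x)) ` (affine hull fiber X s)"
    for X :: "('s \<times> 'a) set"
    unfolding im' affine_hull_translation affine_hull_linear_image[OF blin, symmetric]
    by (simp add: image_image)
  have "rel_interior (C \<inter> L) = rel_interior C \<inter> L"
    by (rule convex_affine_rel_interior_Int[OF C L neL])
  then have "(\<lambda>x. (s, 0) + (0, x)) ` rel_interior (fiber C s) = (\<lambda>x. (s, 0) + (0, x)) ` fiber (rel_interior C) s"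
    using r im by simp
  then show "rel_interior (fiber C s) = fiber (rel_interior C) s"
    using inj_image_eq_iff[OF inj] by blast
  have "affine hull (C \<inter> L) = affine hull C \<inter> L"
  proof
    show "affine hull (C \<inter> L) \<subseteq> affine hull C \<inter> L"
      using L by (intro hull_minimal) (auto intro: affine_Int hull_inc)
    have "openin (top_of_set (affine hull C \<inter> L)) (rel_interior C \<inter> L)"
      using openin_rel_interior[of C] by (auto simp: openin_open)
    moreover have aff: "affine hull (affine hull C \<inter> L) = affine hull C \<inter> L"
      using L by (simp add: affine_Int)
    moreover have "affine hull C \<inter> L \<inter> (rel_interior C \<inter> L) = rel_interior C \<inter> L"
      using rel_interior_subset[of C] hull_subset[of C affine] by blast
    ultimately have "affine hull (rel_interior C \<inter> L) = affine hull C \<inter> L"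
      using affine_hull_convex_Int_openin[of "affine hull C \<inter> L" "rel_interior C \<inter> L"] L neL
      by (metis affine_Int affine_affine_hull affine_imp_convex)
    moreover have "affine hull (rel_interior C \<inter> L) \<subseteq> affine hull (C \<inter> L)"
      using rel_interior_subset by (intro hull_mono) auto
    ultimately show "affine hull C \<inter> L \<subseteq> affine hull (C \<inter> L)" by simp
  qed
  then have "(\<lambda>x. (s, 0) + (0, x)) ` (affine hull (fiber C s)) = (\<lambda>x. (s, 0) + (0, x)) ` fiber (affine hull C) s"
    using h im by simp
  then show "affine hull (fiber C s) = fiber (affine hull C) s"
    using inj_image_eq_iff[OF inj] by blast
qed

text \<open>
  Rank and nullity of the first projection on the space of directions of \<open>A\<close>, counted by means
  of the sum of that space with \<open>{0} \<times> UNIV\<close>.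
\<close>

lemma aff_dim_fst_fiber_affine:
  fixes A :: "('s::euclidean_space \<times> 'a::euclidean_space) set"
  assumes A: "affine A" and a: "(s, x) \<in> A"
  shows "aff_dim A = aff_dim (fst ` A) + aff_dim (fiber A s)"
proof -
  define V where "V = (\<lambda>y. y - (s, x)) ` A"
  define Z where "Z = {0::'s} \<times> (UNIV :: 'a set)"
  have V: "subspace V"
    unfolding V_def using affine_diffs_subspace_subtract[OF A a] by simp
  have Z: "subspace Z" by (auto simp: Z_def subspace_def zero_prod_def)
  have "aff_dim A = int (dim V)"
    unfolding V_def using a by (intro aff_dim_eq_dim_subtract) (simp add: hull_inc)
  moreover have "aff_dim (fst ` A) = int (dim (fst ` V))"
  proof -
    have "fst ` V = (\<lambda>y. y - s) ` fst ` A" by (force simp: V_def)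
    moreover have "s \<in> affine hull (fst ` A)" using a by (force intro: hull_inc)
    ultimately show ?thesis by (simp add: aff_dim_eq_dim_subtract)
  qed
  moreover have "aff_dim (fiber A s) = int (dim (V \<inter> Z))"
  proof -
    have "V \<inter> Z = Pair 0 ` (\<lambda>y. y - x) ` fiber A s"
      by (force simp: V_def Z_def fiber_def)
    moreover have "linear (Pair (0::'s) :: 'a \<Rightarrow> _)" "inj (Pair (0::'s) :: 'a \<Rightarrow> _)"
      by (auto intro!: linearI injI)
    ultimately have "dim (V \<inter> Z) = dim ((\<lambda>y. y - x) ` fiber A s)"
      by (metis dim_image_eq inj_on_subset subset_UNIV)
    moreover have "x \<in> affine hull (fiber A s)" using a by (auto simp: fiber_def intro: hull_inc)
    ultimately show ?thesis by (simp add: aff_dim_eq_dim_subtract)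
  qed
  moreover have "dim V = dim (fst ` V) + dim (V \<inter> Z)"
  proof -
    have "{v + z |v z. v \<in> V \<and> z \<in> Z} = fst ` V \<times> UNIV"
    proof (intro equalityI subsetI)
      fix p :: "'s \<times> 'a" assume "p \<in> fst ` V \<times> UNIV"
      then obtain v where v: "v \<in> V" "fst p = fst v" by (cases p) auto
      then have "p = v + (0, snd p - snd v)" by (simp add: prod_eq_iff)
      then show "p \<in> {v + z |v z. v \<in> V \<and> z \<in> Z}" using v(1) unfolding Z_def by blast
    qed (force simp: Z_def)
    moreover have "dim (fst ` V \<times> (UNIV::'a set)) = dim (fst ` V) + DIM('a)"
      using V by (subst dim_Times) (auto intro: linear_subspace_image linear_fst)
    moreover have "dim Z = DIM('a)"
      unfolding Z_def by (subst dim_Times) auto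
    ultimately show ?thesis using dim_sums_Int[OF V Z] by simp
  qed
  ultimately show ?thesis by simp
qed

lemma aff_dim_fst_fiber:
  fixes C :: "('s::euclidean_space \<times> 'a::euclidean_space) set"
  assumes C: "convex C" and s: "s \<in> rel_interior (fst ` C)"
  shows "aff_dim C = aff_dim (fst ` C) + aff_dim (fiber C s)"
proof -
  obtain x where x: "(s, x) \<in> affine hull C"
    using rel_interior_fiber(3)[OF C s] rel_interior_subset hull_subset
    by (fastforce simp: fiber_def)
  have "aff_dim (affine hull C) = aff_dim (fst ` (affine hull C)) + aff_dim (fiber (affine hull C) s)"
    by (rule aff_dim_fst_fiber_affine[OF affine_affine_hull x])
  also have "fst ` (affine hull C) = affine hull (fst ` C)"
    using affine_hull_linear_image[of fst C] by (simp add: bounded_linear_fst)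
  also have "fiber (affine hull C) s = affine hull (fiber C s)"
    using rel_interior_fiber(2)[OF C s] by simp
  finally show ?thesis by simp
qed



text \<open>
  The part of the notion of an \<open>S\<close> family that governs the faces of the total space. That the
  projection is all of \<open>S\<close> says that no fiber is empty.
\<close>

definition convex_family :: "'s::real_vector set \<Rightarrow> ('s \<times> 'a::real_vector) set \<Rightarrow> bool" where
  "convex_family S P \<longleftrightarrow> fst ` P = S \<and>
     (\<forall>a\<in>S. \<forall>b\<in>S. \<forall>t. 0 \<le> t \<and> t \<le> 1 \<longrightarrow>
        {t *\<^sub>R x + (1 - t) *\<^sub>R y | x y. x \<in> fiber P a \<and> y \<in> fiber P b}
          = fiber P (t *\<^sub>R a + (1 - t) *\<^sub>R b))"

lemma convex_family_convex:
  assumes "convex_family S P"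
  shows "convex P"
  unfolding convex_alt
proof (intro ballI allI impI)
  fix p q u assume pq: "p \<in> P" "q \<in> P" and u: "0 \<le> u \<and> u \<le> (1::real)"
  have S: "fst p \<in> S" "fst q \<in> S" using assms pq by (auto simp: convex_family_def)
  have "u *\<^sub>R snd q + (1 - u) *\<^sub>R snd p \<in> fiber P (u *\<^sub>R fst q + (1 - u) *\<^sub>R fst p)"
    using assms[unfolded convex_family_def, THEN conjunct2, rule_format, OF S(2,1) u] pq
    by (fastforce simp: fiber_def)
  then show "(1 - u) *\<^sub>R p + u *\<^sub>R q \<in> P"
    by (simp add: fiber_def add.commute scaleR_prod_def plus_prod_def)
qed

text \<open>
  If \<open>s\<close> lies between \<open>a\<close> and \<open>b\<close>, every point of \<open>P\<close> over \<open>s\<close> lies between points of \<open>P\<close>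
  over \<open>a\<close> and \<open>b\<close>. So a face of \<open>P\<close> with a point over \<open>s\<close> also has points over \<open>a\<close> and \<open>b\<close>.
\<close>

lemma fst_image_face_of_convex_family:
  assumes P: "convex_family S P" and F: "F face_of P"
  shows "fst ` F face_of S"
  unfolding face_of_def
proof (intro conjI ballI impI)
  show "fst ` F \<subseteq> S" using P face_of_imp_subset[OF F] by (auto simp: convex_family_def)
  show "convex (fst ` F)" by (intro convex_linear_image linear_fst face_of_imp_convex[OF F])
  fix a b s assume ab: "a \<in> S" "b \<in> S" and s: "s \<in> fst ` F" "s \<in> open_segment a b"
  obtain u where u: "0 < u" "u < 1" "s = (1 - u) *\<^sub>R a + u *\<^sub>R b" and ne: "a \<noteq> b"
    using s by (auto simp: in_segment)
  obtain x where x: "(s, x) \<in> F" using s by auto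
  then have "x \<in> fiber P s" using face_of_imp_subset[OF F] by (auto simp: fiber_def)
  moreover have "fiber P s = {u *\<^sub>R x + (1 - u) *\<^sub>R y |x y. x \<in> fiber P b \<and> y \<in> fiber P a}"
    using P[unfolded convex_family_def, THEN conjunct2, rule_format, OF ab(2,1), of u] u
    by (simp add: add.commute)
  ultimately obtain y z where "y \<in> fiber P b" "z \<in> fiber P a" and "x = u *\<^sub>R y + (1 - u) *\<^sub>R z"
    by auto
  then have yz: "(b, y) \<in> P" "(a, z) \<in> P" "x = u *\<^sub>R y + (1 - u) *\<^sub>R z"
    by (auto simp: fiber_def)
  have "(s, x) \<in> open_segment (a, z) (b, y)"
    unfolding in_segment using u yz ne by (intro conjI exI[of _ u]) auto
  then have "(a, z) \<in> F \<and> (b, y) \<in> F" using face_ofD[OF F _ yz(2,1) x] by simp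
  then show "a \<in> fst ` F" "b \<in> fst ` F" by force+
qed

lemma face_of_fiber:
  assumes F: "F face_of P"
  shows "fiber F s face_of fiber P s"
  unfolding face_of_def
proof (intro conjI ballI impI)
  show "fiber F s \<subseteq> fiber P s" using face_of_imp_subset[OF F] by (auto simp: fiber_def)
  have "(s, u *\<^sub>R x + v *\<^sub>R y) \<in> F" if "(s, x) \<in> F" "(s, y) \<in> F" "0 \<le> u" "0 \<le> v" "u + v = 1" for x y u v
    using convexD[OF face_of_imp_convex[OF F] that] that(5) by (simp flip: scaleR_add_left)
  then show "convex (fiber F s)" by (auto simp: convex_def fiber_def)
  fix x y z assume "x \<in> fiber P s" "y \<in> fiber P s" "z \<in> fiber F s" "z \<in> open_segment x y"
  moreover from this have "(s, z) \<in> open_segment (s, x) (s, y)"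
    by (auto simp: in_segment simp flip: scaleR_add_left)
  ultimately have "(s, x) \<in> F \<and> (s, y) \<in> F"
    using face_ofD[OF F, of "(s, z)" "(s, x)" "(s, y)"] by (simp add: fiber_def)
  then show "x \<in> fiber F s" "y \<in> fiber F s" by (auto simp: fiber_def)
qed

text \<open>
  Distinct faces have disjoint relative interiors. Over a point in the relative interior of its
  projection, a face \<open>H\<close> has a slice whose relative interior is part of that of \<open>H\<close>; hence \<open>H\<close> can
  be recovered from the slice. Conversely a face \<open>Q\<close> of the fiber is the slice of the face of \<open>P\<close>
  whose relative interior contains a relative interior point of \<open>Q\<close>; this face projects onto
  the face of \<open>S\<close> that has \<open>s\<close> in its relative interior, which is \<open>F\<close>.
\<close>

lemma bij_betw_faces_fiber:
  fixes P :: "('s::euclidean_space \<times> 'a::euclidean_space) set"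
  assumes P: "convex_family S P" and F: "F \<in> faces S" and s: "s \<in> rel_interior F"
  shows "bij_betw (\<lambda>H. fiber H s) {H \<in> faces P. fst ` H = F} (faces (fiber P s))"
  unfolding bij_betw_def
proof
  have cP: "convex P" using P by (rule convex_family_convex)
  have pos: "fiber (rel_interior H) s \<noteq> {}" "rel_interior (fiber H s) = fiber (rel_interior H) s"
    if "H \<in> faces P" "fst ` H = F" for H
    using rel_interior_fiber[of H s] that s by (auto simp: faces_def face_of_imp_convex)
  show "inj_on (\<lambda>H. fiber H s) {H \<in> faces P. fst ` H = F}"
  proof (rule inj_onI)
    fix H H' assume H: "H \<in> {H \<in> faces P. fst ` H = F}" "H' \<in> {H \<in> faces P. fst ` H = F}"
      and eq: "fiber H s = fiber H' s"
    then have "fiber (rel_interior H) s = fiber (rel_interior H') s"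
      using pos(2)[of H] pos(2)[of H'] by simp
    then have "rel_interior H \<inter> rel_interior H' \<noteq> {}" using pos(1)[of H] H by (auto simp: fiber_def)
    then show "H = H'" using face_of_eq H by (auto simp: faces_def)
  qed
  show "(\<lambda>H. fiber H s) ` {H \<in> faces P. fst ` H = F} = faces (fiber P s)"
  proof (intro equalityI subsetI)
    fix Q assume "Q \<in> (\<lambda>H. fiber H s) ` {H \<in> faces P. fst ` H = F}"
    then obtain H where H: "H \<in> faces P" "fst ` H = F" "Q = fiber H s" by blast
    then have "s \<in> fst ` H" using s rel_interior_subset by blast
    then show "Q \<in> faces (fiber P s)" using H face_of_fiber[of H P s] by (auto simp: faces_def fiber_def)
  next
    fix Q assume Q: "Q \<in> faces (fiber P s)"
    then have "rel_interior Q \<noteq> {}" using rel_interior_eq_empty face_of_imp_convex by (auto simp: faces_def)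
    then obtain x where x: "x \<in> rel_interior Q" by blast
    then have "(s, x) \<in> P"
      using Q rel_interior_subset[of Q] by (auto simp: faces_def fiber_def dest!: face_of_imp_subset)
    then obtain H where H: "H face_of P" "(s, x) \<in> rel_interior H"
      using ex_face_of_rel_interior[OF cP] by blast
    have cH: "convex H" using H face_of_imp_convex by blast
    have "s \<in> fst ` rel_interior H" using H(2) by force
    then have s': "s \<in> rel_interior (fst ` H)"
      using rel_interior_convex_linear_image[OF linear_fst cH] by simp
    then have "fst ` H = F"
      using face_of_eq[OF fst_image_face_of_convex_family[OF P H(1)], of F] F s by (auto simp: faces_def)
    moreover have "fiber H s = Q"
    proof (rule face_of_eq[OF face_of_fiber[OF H(1)]])
      show "Q face_of fiber P s" using Q by (simp add: faces_def)
      show "rel_interior (fiber H s) \<inter> rel_interior Q \<noteq> {}"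
        using rel_interior_fiber(1)[OF cH s'] H(2) x by (auto simp: fiber_def)
    qed
    moreover have "H \<in> faces P" using H rel_interior_subset by (auto simp: faces_def)
    ultimately show "Q \<in> (\<lambda>H. fiber H s) ` {H \<in> faces P. fst ` H = F}" by blast
  qed
qed

lemma face_dim_fiber:
  fixes P :: "('s::euclidean_space \<times> 'a::euclidean_space) set"
  assumes P: "convex_family S P" and H: "H \<in> faces P" and s: "s \<in> rel_interior (fst ` H)"
  shows "face_dim H = face_dim (fst ` H) + face_dim (fiber H s)"
proof -
  have "convex H" using H by (auto simp: faces_def face_of_imp_convex)
  note aff_dim_fst_fiber[OF this s]
  moreover have "s \<in> fst ` H" using s rel_interior_subset by blast
  then have "fst ` H \<noteq> {}" "fiber H s \<noteq> {}" by (auto simp: fiber_def)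
  ultimately show ?thesis
    unfolding face_dim_def by (simp add: nat_add_distrib aff_dim_nonneg)
qed

text \<open>
  The factor \<open>q\<close> to the power \<open>dim F\<close> accounts for the difference in dimension between a face
  over \<open>F\<close> and its slice. The right-hand side does not mention \<open>s\<close>, so the same formula also shows
  that the \<open>f\<close>-polynomial of the fiber is constant on the relative interior of \<open>F\<close>.
\<close>

lemma coeff_shifted_f_poly_fiber:
  fixes P :: "('s::euclidean_space \<times> 'a::euclidean_space) set"
  assumes P: "convex_family S P" and F: "F \<in> faces S" and s: "s \<in> rel_interior F"
  shows "coeff (monom 1 (face_dim F) * f_poly (fiber P s)) k =
    ecard {H \<in> faces P. face_dim H = k \<and> fst ` H = F}"
proof -
  have dim: "face_dim H = face_dim F + face_dim (fiber H s)" if "H \<in> faces P" "fst ` H = F" for H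
    using face_dim_fiber[OF P that(1)] s that(2) by simp
  show ?thesis
  proof (cases "face_dim F \<le> k")
    case False
    then have "{H \<in> faces P. face_dim H = k \<and> fst ` H = F} = {}" using dim by auto
    then show ?thesis using False by (simp only:) (simp add: coeff_monom_mult ecard_def zero_enat_def)
  next
    case True
    have "bij_betw (\<lambda>H. fiber H s) {H \<in> {H \<in> faces P. fst ` H = F}. face_dim H = k}
      {Q \<in> faces (fiber P s). face_dim Q = k - face_dim F}"
      using bij_betw_faces_fiber[OF P F s] dim True
      by (intro bij_betw_Collect) (auto simp: bij_betw_def)
    from ecard_bij_betw[OF this] True show ?thesis
      by (simp add: coeff_monom_mult coeff_f_poly conj_ac)
  qed
qed

lemma f_poly_fiber_eq:
  fixes P :: "('s::euclidean_space \<times> 'a::euclidean_space) set"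
  assumes P: "convex_family S P" and F: "F \<in> faces S"
    and s: "s \<in> rel_interior F" "s' \<in> rel_interior F"
  shows "f_poly (fiber P s) = f_poly (fiber P s')"
proof (rule poly_eqI)
  fix k
  show "coeff (f_poly (fiber P s)) k = coeff (f_poly (fiber P s')) k"
    using coeff_shifted_f_poly_fiber[OF P F s(1), of "face_dim F + k"]
      coeff_shifted_f_poly_fiber[OF P F s(2), of "face_dim F + k"]
    by (simp add: coeff_monom_mult)
qed

lemma coeff_f_poly_convex_family:
  fixes P :: "('s::euclidean_space \<times> 'a::euclidean_space) set"
  assumes P: "convex_family S P"
    and f: "\<And>F. F \<in> faces S \<Longrightarrow> \<exists>s\<in>rel_interior F. f F = f_poly (fiber P s)"
  shows "coeff (f_poly P) k = (\<Sum>\<^sub>\<infinity>F\<in>faces S. coeff (monom 1 (face_dim F) * f F) k)"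
proof -
  let ?X = "\<lambda>F. {H \<in> faces P. face_dim H = k \<and> fst ` H = F}"
  have "{H \<in> faces P. face_dim H = k} = (\<Union>F\<in>faces S. ?X F)"
    using fst_image_face_of_convex_family[OF P] by (auto simp: faces_def)
  then have "coeff (f_poly P) k = ecard (\<Union>F\<in>faces S. ?X F)"
    by (simp add: coeff_f_poly)
  also have "\<dots> = (\<Sum>\<^sub>\<infinity>F\<in>faces S. ecard (?X F))"
    by (rule ecard_UN_disjoint) (auto simp: disjoint_family_on_def)
  also have "\<dots> = (\<Sum>\<^sub>\<infinity>F\<in>faces S. coeff (monom 1 (face_dim F) * f F) k)"
  proof (rule infsum_cong)
    fix F assume F: "F \<in> faces S"
    with f obtain s where "s \<in> rel_interior F" "f F = f_poly (fiber P s)" by blast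
    then show "ecard (?X F) = coeff (monom 1 (face_dim F) * f F) k"
      using coeff_shifted_f_poly_fiber[OF P F] by simp
  qed
  finally show ?thesis .
qed

section \<open>Orbits, ray polyhedra and their Minkowski sums\<close>

lemma scalar_product_add: "scalar_product h (x + y) = scalar_product h x + scalar_product h y"
  by (simp add: scalar_product_def algebra_simps sum.distrib)

lemma scalar_product_diff: "scalar_product h (x - y) = scalar_product h x - scalar_product h (y :: complex ^ 'n)"
  by (simp add: scalar_product_def algebra_simps sum_subtractf)

lemma scalar_product_minus: "scalar_product h (- y) = - scalar_product h (y :: complex ^ 'n)"
  by (simp add: scalar_product_def sum_negf)

lemma scalar_product_mult: "scalar_product h (c *s x) = c * scalar_product h (x :: complex ^ 'n)"
  by (simp add: scalar_product_def algebra_simps sum_distrib_left)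

lemma scaleR_conv_vector_scalar_mult: "r *\<^sub>R x = of_real r *s (x :: complex ^ 'n)"
  unfolding vec_eq_iff vector_scaleR_component vector_smult_component scaleR_conv_of_real[of r "_ :: complex"] by simp

lemma scalar_product_scaleR: "scalar_product h (r *\<^sub>R x) = of_real r * scalar_product h (x :: complex ^ 'n)"
  by (simp add: scaleR_conv_vector_scalar_mult scalar_product_mult)

lemmas scalar_product_simps = scalar_product_add scalar_product_diff scalar_product_minus
  scalar_product_mult scalar_product_scaleR

text \<open>
  The symbols \<open>\<alpha>\<close>, \<open>\<sigma>\<close>, \<open>W\<close> stand for the simple roots, the simple reflections and the
  parabolic subgroups of the Weyl group, and \<open>pr k\<close> for the pairing with the simple coroot of \<open>k\<close>.
\<close>

locale km_algebra =
  fixes G :: "('g::ab_group_add, 'n::finite, 'i::finite) kac_moody_data"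
  assumes km: "kac_moody_algebra G"
begin

abbreviation pr :: "'i \<Rightarrow> complex ^ 'n \<Rightarrow> complex" where
  "pr k \<equiv> scalar_product (coroot G k)"

abbreviation \<alpha> :: "'i \<Rightarrow> complex ^ 'n" where
  "\<alpha> \<equiv> root G"

abbreviation \<sigma> :: "'i \<Rightarrow> complex ^ 'n \<Rightarrow> complex ^ 'n" where
  "\<sigma> \<equiv> simple_reflection G"

abbreviation W :: "'i set \<Rightarrow> (complex ^ 'n \<Rightarrow> complex ^ 'n) set" where
  "W \<equiv> weyl_group G"

lemma pr_root_self: "pr k (\<alpha> k) = 2"
  using km by (simp add: kac_moody_algebra_def realization_def generalized_cartan_matrix_def)

lemma root_ne_0: "\<alpha> k \<noteq> 0"
  using pr_root_self[of k] by (auto simp: scalar_product_def)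

lemma simple_reflection_of_real: "pr k x = of_real r \<Longrightarrow> \<sigma> k x = x - r *\<^sub>R \<alpha> k"
  by (simp add: simple_reflection_def scaleR_conv_vector_scalar_mult)

lemma linear_simple_reflection: "linear (\<sigma> k)"
  by (rule linearI) (simp_all add: simple_reflection_def scalar_product_simps
    scaleR_conv_vector_scalar_mult vec.scale_left_distrib algebra_simps vector_smult_assoc)

lemma simple_reflection_involutive: "\<sigma> k (\<sigma> k x) = x"
  by (simp add: simple_reflection_def scalar_product_simps pr_root_self vec_eq_iff algebra_simps)

lemma pr_simple_reflection: "pr k (\<sigma> k x) = - pr k x"
  by (simp add: simple_reflection_def scalar_product_simps pr_root_self)

lemma linear_weyl_group: "w \<in> W J \<Longrightarrow> linear w"
  by (induction rule: weyl_group.induct)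
    (simp_all only: linear_id linear_compose[OF _ linear_simple_reflection])

lemma weyl_group_comp: "u \<in> W J \<Longrightarrow> w \<in> W J \<Longrightarrow> u \<circ> w \<in> W J"
  by (induction rule: weyl_group.induct) (auto simp: comp_assoc intro: weyl_group.intros)

lemma simple_reflection_in_weyl_group: "k \<in> J \<Longrightarrow> \<sigma> k \<in> W J"
  using weyl_group.intros(2)[OF weyl_group.intros(1)] by simp

lemma weyl_group_inverse:
  assumes "w \<in> W J"
  obtains u where "u \<in> W J" "\<And>x. u (w x) = x" "\<And>x. w (u x) = x"
proof -
  have "\<exists>u\<in>W J. (\<forall>x. u (w x) = x) \<and> (\<forall>x. w (u x) = x)"
    using assms
  proof (induction rule: weyl_group.induct)
    case 1
    then show ?case by (auto intro!: bexI[of _ id] weyl_group.intros)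
  next
    case (2 w j)
    then obtain u where "u \<in> W J" "\<forall>x. u (w x) = x" "\<forall>x. w (u x) = x" by blast
    then show ?case
      using 2(2) by (intro bexI[of _ "u \<circ> \<sigma> j"])
        (auto simp: simple_reflection_involutive intro: weyl_group_comp simple_reflection_in_weyl_group)
  qed
  then show thesis using that by blast
qed

definition reflection_closed :: "'i set \<Rightarrow> (complex ^ 'n) set \<Rightarrow> bool" where
  "reflection_closed J X \<longleftrightarrow> (\<forall>k\<in>J. \<forall>x\<in>X. \<sigma> k x \<in> X)"

lemma reflection_closed_weyl_group:
  assumes "reflection_closed J X" "w \<in> W J" "x \<in> X"
  shows "w x \<in> X"
  using assms(2) by (induction rule: weyl_group.induct) (use assms in \<open>auto simp: reflection_closed_def\<close>)

lemma reflection_closed_convex_hull: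
  assumes "reflection_closed J X"
  shows "reflection_closed J (convex hull X)"
  unfolding reflection_closed_def
proof (intro ballI)
  fix k x assume k: "k \<in> J" and x: "x \<in> convex hull X"
  have "\<sigma> k x \<in> convex hull (\<sigma> k ` X)"
    using x convex_hull_linear_image[OF linear_simple_reflection] by blast
  also have "\<dots> \<subseteq> convex hull X"
    using assms k by (intro hull_mono) (auto simp: reflection_closed_def)
  finally show "\<sigma> k x \<in> convex hull X" .
qed

definition orbit :: "'i set \<Rightarrow> complex ^ 'n \<Rightarrow> (complex ^ 'n) set" where
  "orbit J \<nu> = (\<lambda>w. w \<nu>) ` W J"

lemma orbitI: "w \<in> W J \<Longrightarrow> w \<nu> \<in> orbit J \<nu>"
  by (simp add: orbit_def)

lemma reflection_closed_orbit: "reflection_closed J (orbit J \<nu>)"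
  unfolding reflection_closed_def
proof (intro ballI)
  fix k x assume k: "k \<in> J" and "x \<in> orbit J \<nu>"
  then obtain w where "w \<in> W J" "x = w \<nu>" by (auto simp: orbit_def)
  then show "\<sigma> k x \<in> orbit J \<nu>" using orbitI[OF weyl_group.intros(2)[OF _ k]] by simp
qed

lemma self_in_orbit: "\<nu> \<in> orbit J \<nu>"
  using orbitI[OF weyl_group.intros(1)] by simp

lemma orbit_scaleR: "x \<in> orbit J \<nu> \<Longrightarrow> t *\<^sub>R x \<in> orbit J (t *\<^sub>R \<nu>)"
  unfolding orbit_def by (force simp: linear_scale[OF linear_weyl_group])

lemma dominant_add: "x \<in> dominant G J \<Longrightarrow> y \<in> dominant G J \<Longrightarrow> x + y \<in> dominant G J"
  by (auto simp: dominant_def scalar_product_simps intro!: nonneg_Reals_add_I)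

lemma dominant_scaleR: "x \<in> dominant G J \<Longrightarrow> 0 \<le> t \<Longrightarrow> t *\<^sub>R x \<in> dominant G J"
  by (auto simp: dominant_def scalar_product_simps intro!: nonneg_Reals_mult_I)

lemma dominant_0: "0 \<in> dominant G J"
  by (simp add: dominant_def scalar_product_def)

lemma dominant_sum: "(\<And>m. m < N \<Longrightarrow> 0 \<le> t m \<and> x m \<in> dominant G J) \<Longrightarrow>
    (\<Sum>m<(N::nat). t m *\<^sub>R x m) \<in> dominant G J"
  by (induction N) (auto intro: dominant_0 dominant_add dominant_scaleR)

lemma dominant_pr:
  assumes "x \<in> dominant G J" "k \<in> J"
  obtains r where "0 \<le> r" "pr k x = of_real r"
  using assms by (auto simp: dominant_def nonneg_Reals_def)

text \<open>
  Starting from a dominant \<open>\<nu>\<close>, one may apply simple reflections in \<open>J\<close> as long as each of them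
  subtracts a nonnegative multiple of the simple root. That the whole orbit is reached in this way
  is usually read off from reduced words and the positivity of coroots. Below it is deduced,
  for the weights that occur, from modules in which they are highest weights.
\<close>

inductive_set descents :: "'i set \<Rightarrow> complex ^ 'n \<Rightarrow> (complex ^ 'n) set" for J \<nu> where
  start: "\<nu> \<in> descents J \<nu>"
| step: "y \<in> descents J \<nu> \<Longrightarrow> k \<in> J \<Longrightarrow> pr k y \<in> \<real>\<^sub>\<ge>\<^sub>0 \<Longrightarrow> \<sigma> k y \<in> descents J \<nu>"

definition descending :: "'i set \<Rightarrow> complex ^ 'n \<Rightarrow> bool" where
  "descending J \<nu> \<longleftrightarrow> orbit J \<nu> \<subseteq> descents J \<nu>"

lemma descents_scaleR:
  assumes "y \<in> descents J \<nu>" "0 \<le> t"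
  shows "t *\<^sub>R y \<in> descents J (t *\<^sub>R \<nu>)"
  using assms(1)
proof (induction rule: descents.induct)
  case start
  then show ?case by (rule descents.start)
next
  case (step y k)
  have "\<sigma> k (t *\<^sub>R y) \<in> descents J (t *\<^sub>R \<nu>)"
    using step assms(2) by (intro descents.step) (auto simp: scalar_product_simps intro!: nonneg_Reals_mult_I)
  then show ?case by (simp add: linear_scale[OF linear_simple_reflection])
qed

lemma descending_scaleR:
  assumes "descending J \<nu>" "0 \<le> t"
  shows "descending J (t *\<^sub>R \<nu>)"
  unfolding descending_def
proof
  fix x assume "x \<in> orbit J (t *\<^sub>R \<nu>)"
  then obtain w where w: "w \<in> W J" "x = t *\<^sub>R w \<nu>"
    by (auto simp: orbit_def linear_scale[OF linear_weyl_group])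
  then have "w \<nu> \<in> descents J \<nu>" using assms(1) by (auto simp: descending_def orbit_def)
  then show "x \<in> descents J (t *\<^sub>R \<nu>)" using w assms(2) by (simp add: descents_scaleR)
qed

text \<open>
  The reason for looking at descents. With \<open>l\<close> and \<open>m\<close> the nonnegative pairings of \<open>a\<close> and \<open>y\<close>
  with the coroot, \<open>a + \<sigma> k y\<close> is \<open>a + y\<close> minus \<open>m\<close> times the root, while the mirror image of
  \<open>a + y\<close> is \<open>a + y\<close> minus \<open>l + m\<close> times the root. So the first point lies between \<open>a + y\<close> and
  its mirror image, both of which are in \<open>X\<close>.
\<close>

lemma add_descents_mem:
  assumes X: "convex X" "reflection_closed J X"
    and a: "a \<in> dominant G J" and ab: "a + b \<in> X" and y: "y \<in> descents J b"
  shows "a + y \<in> X"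
  using y
proof (induction rule: descents.induct)
  case start
  then show ?case by (rule ab)
next
  case (step y k)
  obtain l where l: "0 \<le> l" "pr k a = of_real l" using dominant_pr[OF a step(2)] .
  obtain m where m: "0 \<le> m" "pr k y = of_real m" using step(3) by (auto simp: nonneg_Reals_def)
  have s: "\<sigma> k (a + y) = (a + y) - (l + m) *\<^sub>R \<alpha> k"
    using l m by (intro simple_reflection_of_real) (simp add: scalar_product_simps)
  have "\<sigma> k (a + y) \<in> X" using X(2) step(2,4) by (simp add: reflection_closed_def)
  then have "closed_segment (a + y) (\<sigma> k (a + y)) \<subseteq> X" by (rule closed_segment_subset[OF step(4) _ X(1)])
  moreover have "a + \<sigma> k y = a + y - m *\<^sub>R \<alpha> k"
    using m simple_reflection_of_real by simp
  moreover have "a + y - m *\<^sub>R \<alpha> k \<in> closed_segment (a + y) (a + y - (l + m) *\<^sub>R \<alpha> k)"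
  proof (cases "l + m = 0")
    case True
    then show ?thesis using l m by (simp add: add_nonneg_eq_0_iff)
  next
    case False
    define u where "u = m / (l + m)"
    have "a + y - m *\<^sub>R \<alpha> k = (1 - u) *\<^sub>R (a + y) + u *\<^sub>R (a + y - (l + m) *\<^sub>R \<alpha> k)"
      using False by (simp add: u_def scaleR_diff_right scaleR_diff_left)
    moreover have "0 \<le> u" "u \<le> 1" using l m by (auto simp: u_def divide_simps)
    ultimately show ?thesis unfolding in_segment by blast
  qed
  ultimately show ?case unfolding s by (simp only: subset_iff)
qed

lemma convex_hull_orbit_add:
  assumes a: "a \<in> dominant G J" and b: "descending J b"
    and x: "x \<in> convex hull orbit J a" and y: "y \<in> convex hull orbit J b"
  shows "x + y \<in> convex hull orbit J (a + b)"
proof -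
  let ?C = "convex hull orbit J (a + b)"
  have C: "convex ?C" "reflection_closed J ?C" "a + b \<in> ?C"
    using reflection_closed_convex_hull reflection_closed_orbit self_in_orbit by (auto intro: hull_inc)
  have 1: "p + q \<in> ?C" if p: "p \<in> orbit J a" and q: "q \<in> orbit J b" for p q
  proof -
    obtain u where u: "u \<in> W J" "p = u a" using p by (auto simp: orbit_def)
    obtain u' where u': "u' \<in> W J" "\<And>x. u (u' x) = x" using weyl_group_inverse[OF u(1)] by metis
    have "u' q \<in> orbit J b" by (rule reflection_closed_weyl_group[OF reflection_closed_orbit u'(1) q])
    then have "u' q \<in> descents J b" using b unfolding descending_def by blast
    then have "a + u' q \<in> ?C" by (rule add_descents_mem[OF C(1,2) a C(3)])
    then have "u (a + u' q) \<in> ?C" by (rule reflection_closed_weyl_group[OF C(2) u(1)])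
    then show ?thesis using u u' by (simp add: linear_add[OF linear_weyl_group])
  qed
  have conv: "convex {q. p + q \<in> ?C}" for p
  proof -
    have "{q. p + q \<in> ?C} = (+) (- p) ` ?C" by (force simp: image_iff algebra_simps)
    then show ?thesis using convex_translation[OF C(1)] by simp
  qed
  have "convex hull orbit J b \<subseteq> {q. p + q \<in> ?C}" if "p \<in> orbit J a" for p
    using 1[OF that] conv by (intro hull_minimal) auto
  then have "orbit J a \<subseteq> {p. y + p \<in> ?C}" using y by (auto simp: add.commute)
  then have "convex hull orbit J a \<subseteq> {p. y + p \<in> ?C}" using conv by (intro hull_minimal) auto
  then show ?thesis using x by (auto simp: add.commute)
qed

text \<open>
  For dominant \<open>\<nu>\<close> the polyhedron \<open>P_polyhedron G \<nu> J\<close> is the hull of the orbit of \<open>\<nu>\<close> minus this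
  cone. In that form it visibly absorbs the negatives of the simple roots outside \<open>J\<close>, and convex
  combinations can be taken in the two parts separately.
\<close>

definition orbit_cone :: "'i set \<Rightarrow> (complex ^ 'n) set" where
  "orbit_cone J = convex_cone hull (\<Union>i\<in>-J. orbit J (\<alpha> i))"

definition ray_polyhedron :: "'i set \<Rightarrow> complex ^ 'n \<Rightarrow> (complex ^ 'n) set" where
  "ray_polyhedron J \<nu> = {x - d | x d. x \<in> convex hull orbit J \<nu> \<and> d \<in> orbit_cone J}"

lemma reflection_closed_orbit_cone: "reflection_closed J (orbit_cone J)"
  unfolding reflection_closed_def
proof (intro ballI)
  fix k x assume k: "k \<in> J" and "x \<in> orbit_cone J"
  then have "\<sigma> k x \<in> convex_cone hull (\<sigma> k ` (\<Union>i\<in>-J. orbit J (\<alpha> i)))"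
    unfolding orbit_cone_def convex_cone_hull_linear_image[OF linear_simple_reflection] by blast
  also have "\<dots> \<subseteq> orbit_cone J"
    using reflection_closed_orbit k unfolding orbit_cone_def
    by (intro hull_mono) (fastforce simp: reflection_closed_def)
  finally show "\<sigma> k x \<in> orbit_cone J" .
qed

lemma reflection_closed_ray_polyhedron: "reflection_closed J (ray_polyhedron J \<nu>)"
  using reflection_closed_orbit_cone[of J] reflection_closed_convex_hull[OF reflection_closed_orbit[of J \<nu>]]
  unfolding reflection_closed_def ray_polyhedron_def
  by (auto simp: linear_diff[OF linear_simple_reflection]) blast

lemma convex_ray_polyhedron: "convex (ray_polyhedron J \<nu>)"
proof -
  have "{x - d |x d. x \<in> A \<and> d \<in> B} = (\<Union>x\<in>A. \<Union>d\<in>B. {x - d})" for A B :: "(complex ^ 'n) set"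
    by blast
  then show ?thesis
    unfolding ray_polyhedron_def orbit_cone_def
    by (simp only: convex_differences[OF convex_convex_hull convex_convex_cone_hull])
qed

lemma ray_polyhedron_minus_root:
  assumes "x \<in> ray_polyhedron J \<nu>" "i \<notin> J" "0 \<le> t"
  shows "x - t *\<^sub>R \<alpha> i \<in> ray_polyhedron J \<nu>"
proof -
  obtain y d where y: "x = y - d" "y \<in> convex hull orbit J \<nu>" "d \<in> orbit_cone J"
    using assms(1) by (auto simp: ray_polyhedron_def)
  have "\<alpha> i \<in> orbit_cone J"
    unfolding orbit_cone_def using assms(2) self_in_orbit by (intro hull_inc) blast
  then have "d + t *\<^sub>R \<alpha> i \<in> orbit_cone J"
    using y assms unfolding orbit_cone_def by (intro convex_cone_hull_add convex_cone_hull_mul)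
  moreover have "x - t *\<^sub>R \<alpha> i = y - (d + t *\<^sub>R \<alpha> i)" using y by simp
  ultimately show ?thesis using y(2) unfolding ray_polyhedron_def by blast
qed

lemma self_in_ray_polyhedron: "\<nu> \<in> ray_polyhedron J \<nu>"
proof -
  have "\<nu> = \<nu> - 0" "\<nu> \<in> convex hull orbit J \<nu>" "0 \<in> orbit_cone J"
    by (simp_all add: self_in_orbit hull_inc orbit_cone_def convex_cone_hull_contains_0)
  then show ?thesis unfolding ray_polyhedron_def by blast
qed

text \<open>
  The set of directions \<open>d\<close> such that the ray from every point of the orbit in the direction
  \<open>- d\<close> stays in \<open>X\<close> is a convex cone, so it is enough that it contains the orbits of the simple
  roots outside \<open>J\<close>. For these, walk down from the ray \<open>\<nu> - c \<alpha> i\<close> along the descents of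
  \<open>- c \<alpha> i\<close>.
\<close>

lemma ray_polyhedron_subset:
  assumes X: "convex X" "reflection_closed J X" and \<nu>: "\<nu> \<in> dominant G J" "\<nu> \<in> X"
    and rays: "\<And>i t. i \<notin> J \<Longrightarrow> 0 \<le> t \<Longrightarrow> \<nu> - t *\<^sub>R \<alpha> i \<in> X"
    and desc: "\<And>i. i \<notin> J \<Longrightarrow> descending J (- \<alpha> i)"
  shows "ray_polyhedron J \<nu> \<subseteq> X"
proof -
  \<comment> \<open>The directions along which \<open>X\<close> recedes from every point of the orbit.\<close>
  define D where "D = {d. \<forall>c\<ge>0. \<forall>u\<in>W J. u \<nu> - c *\<^sub>R d \<in> X}"
  have "(\<Union>i\<in>-J. orbit J (\<alpha> i)) \<subseteq> D"
  proof
    fix x assume "x \<in> (\<Union>i\<in>-J. orbit J (\<alpha> i))"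
    then obtain i w where iw: "i \<notin> J" "w \<in> W J" "x = w (\<alpha> i)" by (auto simp: orbit_def)
    have "u \<nu> - c *\<^sub>R x \<in> X" if c: "0 \<le> c" and u: "u \<in> W J" for c u
    proof -
      obtain u' where u': "u' \<in> W J" "\<And>x. u (u' x) = x" using weyl_group_inverse[OF u] by metis
      have "descending J (c *\<^sub>R (- \<alpha> i))" using descending_scaleR[OF desc[OF iw(1)] c] .
      moreover have "u' (w (c *\<^sub>R (- \<alpha> i))) \<in> orbit J (c *\<^sub>R (- \<alpha> i))"
        using orbitI[OF weyl_group_comp[OF u'(1) iw(2)]] by simp
      ultimately have "u' (w (c *\<^sub>R (- \<alpha> i))) \<in> descents J (c *\<^sub>R (- \<alpha> i))"
        unfolding descending_def by (rule subsetD)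
      moreover have "\<nu> + c *\<^sub>R (- \<alpha> i) \<in> X" using rays[OF iw(1) c] by simp
      ultimately have "\<nu> + u' (w (c *\<^sub>R (- \<alpha> i))) \<in> X"
        by (rule add_descents_mem[OF X \<nu>(1), rotated])
      then have "u (\<nu> + u' (w (c *\<^sub>R (- \<alpha> i)))) \<in> X" by (rule reflection_closed_weyl_group[OF X(2) u])
      then show ?thesis
        using u' iw by (simp add: linear_add[OF linear_weyl_group[OF u]] linear_scale[OF linear_weyl_group[OF iw(2)]]
            linear_neg[OF linear_weyl_group[OF iw(2)]])
    qed
    then show "x \<in> D" by (simp add: D_def)
  qed
  moreover have "convex_cone D"
  proof -
    have "0 \<in> D" using reflection_closed_weyl_group[OF X(2) _ \<nu>(2)] by (simp add: D_def)
    moreover have "x + y \<in> D" if "x \<in> D" "y \<in> D" for x y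
    proof -
      have "u \<nu> - c *\<^sub>R (x + y) \<in> X" if c: "0 \<le> c" and u: "u \<in> W J" for c u
      proof -
        have "u \<nu> - (2 * c) *\<^sub>R x \<in> X" "u \<nu> - (2 * c) *\<^sub>R y \<in> X"
          using \<open>x \<in> D\<close> \<open>y \<in> D\<close> c u by (auto simp: D_def)
        then have "(1/2) *\<^sub>R (u \<nu> - (2 * c) *\<^sub>R x) + (1/2) *\<^sub>R (u \<nu> - (2 * c) *\<^sub>R y) \<in> X"
          by (intro convexD[OF X(1)]) auto
        also have "(1/2) *\<^sub>R (u \<nu> - (2 * c) *\<^sub>R x) + (1/2) *\<^sub>R (u \<nu> - (2 * c) *\<^sub>R y) =
            (1/2) *\<^sub>R (u \<nu> + u \<nu>) - c *\<^sub>R (x + y)"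
          by (simp add: algebra_simps del: scaleR_half_double)
        finally show ?thesis by simp
      qed
      then show ?thesis by (simp add: D_def)
    qed
    moreover have "c *\<^sub>R x \<in> D" if "x \<in> D" "0 \<le> c" for x c
      using that by (auto simp: D_def)
    ultimately show ?thesis unfolding convex_cone_iff by blast
  qed
  ultimately have D: "orbit_cone J \<subseteq> D" unfolding orbit_cone_def by (rule hull_minimal)
  have "x - d \<in> X" if "x \<in> convex hull orbit J \<nu>" "d \<in> orbit_cone J" for x d
  proof -
    have "u \<nu> - 1 *\<^sub>R d \<in> X" if "u \<in> W J" for u
      using subsetD[OF D \<open>d \<in> orbit_cone J\<close>] that unfolding D_def by (simp del: scaleR_one)
    then have "y \<in> (\<lambda>x. d + x) ` X" if "y \<in> orbit J \<nu>" for y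
      using that by (intro rev_image_eqI[of "y - d"]) (auto simp: orbit_def)
    then have "orbit J \<nu> \<subseteq> (\<lambda>x. d + x) ` X" by blast
    moreover have "convex ((\<lambda>x. d + x) ` X)" using X(1) by (rule convex_translation)
    ultimately have "convex hull orbit J \<nu> \<subseteq> (\<lambda>x. d + x) ` X" by (rule hull_minimal)
    then show ?thesis using that(1) by auto
  qed
  then show ?thesis by (auto simp: ray_polyhedron_def)
qed

lemma P_polyhedron_eq_ray_polyhedron:
  assumes \<nu>: "\<nu> \<in> dominant G J" and desc: "\<And>i. i \<notin> J \<Longrightarrow> descending J (- \<alpha> i)"
  shows "P_polyhedron G \<nu> J = ray_polyhedron J \<nu>"
proof (cases "J = UNIV")
  case True
  then have "orbit_cone J = {0}" by (simp add: orbit_cone_def)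
  then show ?thesis using True by (simp add: P_polyhedron_def ray_polyhedron_def orbit_def)
next
  case False
  define R where "R = (\<Union>w\<in>W J. \<Union>i\<in>UNIV - J. w ` {\<nu> - t *\<^sub>R \<alpha> i | t::real. 0 \<le> t})"
  have P: "P_polyhedron G \<nu> J = convex hull R" using False by (simp add: P_polyhedron_def R_def)
  have "w (\<nu> - t *\<^sub>R \<alpha> i) \<in> ray_polyhedron J \<nu>" if "w \<in> W J" "i \<notin> J" "0 \<le> t" for w i t
    by (rule reflection_closed_weyl_group[OF reflection_closed_ray_polyhedron that(1)
      ray_polyhedron_minus_root[OF self_in_ray_polyhedron that(2,3)]])
  then have "R \<subseteq> ray_polyhedron J \<nu>" by (auto simp: R_def)
  then have "convex hull R \<subseteq> ray_polyhedron J \<nu>"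
    using convex_ray_polyhedron by (rule hull_minimal)
  moreover have "ray_polyhedron J \<nu> \<subseteq> convex hull R"
  proof (rule ray_polyhedron_subset[OF convex_convex_hull _ \<nu> _ _ desc])
    have "reflection_closed J R"
      unfolding reflection_closed_def
    proof (intro ballI)
      fix k x assume k: "k \<in> J" and "x \<in> R"
      then obtain w i t where w: "w \<in> W J" "i \<in> UNIV - J" "0 \<le> (t::real)" "x = w (\<nu> - t *\<^sub>R \<alpha> i)"
        by (auto simp: R_def)
      have "\<sigma> k x = (\<sigma> k \<circ> w) (\<nu> - t *\<^sub>R \<alpha> i)" "\<sigma> k \<circ> w \<in> W J"
        using w k weyl_group.intros(2) by auto
      then show "\<sigma> k x \<in> R" unfolding R_def using w(2,3) by blast
    qed
    then show "reflection_closed J (convex hull R)" by (rule reflection_closed_convex_hull)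
    show r: "\<nu> - t *\<^sub>R \<alpha> i \<in> convex hull R" if "i \<notin> J" "0 \<le> t" for i and t :: real
    proof (rule hull_inc)
      have "id (\<nu> - t *\<^sub>R \<alpha> i) \<in> R"
        unfolding R_def using that weyl_group.intros(1)[of G J] by blast
      then show "\<nu> - t *\<^sub>R \<alpha> i \<in> R" by simp
    qed
    show "\<nu> \<in> convex hull R" using r[of _ 0] False by auto
  qed
  ultimately show ?thesis using P by simp
qed

text \<open>
  For general orbits only the opposite inclusion between a Minkowski sum of orbit hulls and the
  orbit hull of the sum holds; dominance and descents give this one.
\<close>

lemma sum_in_convex_hull_orbit:
  assumes "\<And>m. m < N \<Longrightarrow> 0 \<le> t m \<and> \<nu> m \<in> dominant G J \<and> descending J (\<nu> m) \<and> x m \<in> convex hull orbit J (\<nu> m)"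
  shows "(\<Sum>m<(N::nat). t m *\<^sub>R x m) \<in> convex hull orbit J (\<Sum>m<N. t m *\<^sub>R \<nu> m)"
  using assms
proof (induction N)
  case 0
  then show ?case using self_in_orbit by (auto intro: hull_inc)
next
  case (Suc N)
  have "t N *\<^sub>R x N \<in> (*\<^sub>R) (t N) ` (convex hull orbit J (\<nu> N))" using Suc.prems[of N] by auto
  also have "\<dots> = convex hull ((*\<^sub>R) (t N) ` orbit J (\<nu> N))" by (simp add: convex_hull_scaling)
  also have "\<dots> \<subseteq> convex hull orbit J (t N *\<^sub>R \<nu> N)" by (intro hull_mono) (auto intro: orbit_scaleR)
  finally have "t N *\<^sub>R x N \<in> convex hull orbit J (t N *\<^sub>R \<nu> N)" .
  moreover have "(\<Sum>m<N. t m *\<^sub>R \<nu> m) \<in> dominant G J" "descending J (t N *\<^sub>R \<nu> N)"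
    using Suc.prems by (simp_all add: dominant_sum descending_scaleR)
  moreover have "(\<Sum>m<N. t m *\<^sub>R x m) \<in> convex hull orbit J (\<Sum>m<N. t m *\<^sub>R \<nu> m)"
    using Suc by simp
  ultimately show ?case by (simp add: convex_hull_orbit_add)
qed

text \<open>
  Minkowski combinations of these polyhedra are taken in the parameter. The cone part is shared by
  all summands, and as the coefficients sum to 1 it can be distributed to them.
\<close>

lemma ray_polyhedron_sum:
  assumes t: "\<And>m. m < N \<Longrightarrow> 0 \<le> t m" "(\<Sum>m<(N::nat). t m) = 1"
    and \<nu>: "\<And>m. m < N \<Longrightarrow> \<nu> m \<in> dominant G J" "\<And>m. m < N \<Longrightarrow> descending J (\<nu> m)"
  shows "{\<Sum>m<N. t m *\<^sub>R x m | x. \<forall>m<N. x m \<in> ray_polyhedron J (\<nu> m)} =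
    ray_polyhedron J (\<Sum>m<N. t m *\<^sub>R \<nu> m)"
proof (intro equalityI subsetI)
  fix z assume "z \<in> {\<Sum>m<N. t m *\<^sub>R x m | x. \<forall>m<N. x m \<in> ray_polyhedron J (\<nu> m)}"
  then obtain x where x: "z = (\<Sum>m<N. t m *\<^sub>R x m)" "\<forall>m<N. x m \<in> ray_polyhedron J (\<nu> m)" by blast
  then have "\<forall>m. \<exists>y d. m < N \<longrightarrow> x m = y - d \<and> y \<in> convex hull orbit J (\<nu> m) \<and> d \<in> orbit_cone J"
    by (auto simp: ray_polyhedron_def)
  then obtain y d where yd: "\<And>m. m < N \<Longrightarrow> x m = y m - d m"
    "\<And>m. m < N \<Longrightarrow> y m \<in> convex hull orbit J (\<nu> m)" "\<And>m. m < N \<Longrightarrow> d m \<in> orbit_cone J" by metis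
  have "z = (\<Sum>m<N. t m *\<^sub>R y m) - (\<Sum>m<N. t m *\<^sub>R d m)"
    using yd(1) by (simp add: x(1) scaleR_diff_right sum_subtractf)
  moreover have "(\<Sum>m<N. t m *\<^sub>R y m) \<in> convex hull orbit J (\<Sum>m<N. t m *\<^sub>R \<nu> m)"
    using t \<nu> yd by (intro sum_in_convex_hull_orbit) auto
  moreover have "(\<Sum>m<N'. t m *\<^sub>R d m) \<in> orbit_cone J" if "N' \<le> N" for N'
    using that t(1) yd(3) unfolding orbit_cone_def
    by (induction N') (simp_all add: convex_cone_hull_contains_0 convex_cone_hull_add convex_cone_hull_mul)
  ultimately show "z \<in> ray_polyhedron J (\<Sum>m<N. t m *\<^sub>R \<nu> m)"
    unfolding ray_polyhedron_def by blast
next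
  fix z assume "z \<in> ray_polyhedron J (\<Sum>m<N. t m *\<^sub>R \<nu> m)"
  then obtain y d where z: "z = y - d" "y \<in> convex hull orbit J (\<Sum>m<N. t m *\<^sub>R \<nu> m)" "d \<in> orbit_cone J"
    by (auto simp: ray_polyhedron_def)
  define Y where "Y = {\<Sum>m<N. t m *\<^sub>R x m | x. \<forall>m<N. x m \<in> convex hull orbit J (\<nu> m)}"
  have "convex Y"
    unfolding convex_def
  proof (intro ballI allI impI)
    fix p q and u v :: real
    assume pq: "p \<in> Y" "q \<in> Y" and uv: "0 \<le> u" "0 \<le> v" "u + v = 1"
    then obtain x y where x: "p = (\<Sum>m<N. t m *\<^sub>R x m)" "\<forall>m<N. x m \<in> convex hull orbit J (\<nu> m)"
      and y: "q = (\<Sum>m<N. t m *\<^sub>R y m)" "\<forall>m<N. y m \<in> convex hull orbit J (\<nu> m)"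
      by (auto simp: Y_def)
    have "u *\<^sub>R p + v *\<^sub>R q = (\<Sum>m<N. t m *\<^sub>R (u *\<^sub>R x m + v *\<^sub>R y m))"
      by (simp add: x y scaleR_sum_right sum.distrib algebra_simps)
    then show "u *\<^sub>R p + v *\<^sub>R q \<in> Y"
      unfolding Y_def using x(2) y(2) uv by (auto intro!: convexD)
  qed
  moreover have "orbit J (\<Sum>m<N. t m *\<^sub>R \<nu> m) \<subseteq> Y"
  proof
    fix p assume "p \<in> orbit J (\<Sum>m<N. t m *\<^sub>R \<nu> m)"
    then obtain w where w: "w \<in> W J" "p = w (\<Sum>m<N. t m *\<^sub>R \<nu> m)" by (auto simp: orbit_def)
    have "p = (\<Sum>m<N. t m *\<^sub>R w (\<nu> m))"
      by (simp add: w linear_sum[OF linear_weyl_group[OF w(1)]] linear_scale[OF linear_weyl_group[OF w(1)]])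
    moreover have "w (\<nu> m) \<in> convex hull orbit J (\<nu> m)" for m
      using w(1) by (auto simp: orbit_def intro!: hull_inc)
    ultimately show "p \<in> Y" by (auto simp: Y_def)
  qed
  ultimately have "convex hull orbit J (\<Sum>m<N. t m *\<^sub>R \<nu> m) \<subseteq> Y" by (metis hull_minimal)
  then obtain x where x: "y = (\<Sum>m<N. t m *\<^sub>R x m)" "\<forall>m<N. x m \<in> convex hull orbit J (\<nu> m)"
    using z(2) by (auto simp: Y_def)
  have "z = (\<Sum>m<N. t m *\<^sub>R (x m - d))"
    using t(2) by (simp add: z(1) x(1) scaleR_diff_right sum_subtractf flip: scaleR_sum_left)
  moreover have "\<forall>m<N. x m - d \<in> ray_polyhedron J (\<nu> m)"
    using x(2) z(3) by (auto simp: ray_polyhedron_def)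
  ultimately show "z \<in> {\<Sum>m<N. t m *\<^sub>R x m | x. \<forall>m<N. x m \<in> ray_polyhedron J (\<nu> m)}"
    by (intro CollectI exI[of _ "\<lambda>m. x m - d"] conjI)
qed

end

section \<open>Weights of integrable modules\<close>

context km_algebra begin

text \<open>
  Elements of the positive root cone are recorded by their coefficient functions, which are unique
  since the simple roots are independent; the sum of the coefficients is the height used in the
  inductions below.
\<close>

definition root_sum :: "('i \<Rightarrow> nat) \<Rightarrow> complex ^ 'n" where
  "root_sum n = (\<Sum>i\<in>UNIV. real (n i) *\<^sub>R \<alpha> i)"

lemma real_combination_roots_eq_0:
  assumes "(\<Sum>i\<in>UNIV. c i *\<^sub>R \<alpha> i) = 0"
  shows "c i = 0"
proof -
  have inj: "inj \<alpha>" and ind: "vec.independent (range \<alpha>)"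
    using km by (auto simp: kac_moody_algebra_def realization_def)
  let ?u = "\<lambda>v. of_real (c (inv \<alpha> v)) :: complex"
  have "(\<Sum>v\<in>range \<alpha>. ?u v *s v) = 0"
    using assms inj by (simp add: sum.reindex scaleR_conv_vector_scalar_mult)
  then have "?u (\<alpha> i) = 0"
    using ind by (intro vec.independentD[of "range \<alpha>" "range \<alpha>" ?u "\<alpha> i"]) auto
  then show ?thesis using inj by simp
qed

lemma root_sum_0: "root_sum (\<lambda>_. 0) = 0"
  by (simp add: root_sum_def)

lemma root_sum_add: "root_sum (\<lambda>i. n i + m i) = root_sum n + root_sum m"
  by (simp add: root_sum_def scaleR_add_left sum.distrib)

lemma root_sum_mult: "root_sum (\<lambda>i. m * n i) = real m *\<^sub>R root_sum n"
  by (simp add: root_sum_def scaleR_sum_right)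

lemma root_sum_single: "root_sum (\<lambda>i. if i = k then m else 0) = real m *\<^sub>R \<alpha> k"
  by (simp add: root_sum_def if_distrib if_distribR sum.delta cong: if_cong)

text \<open>
  One simple root more or less. These are opaque constants so that the coefficient functions
  keep a normal form in the index of a graded piece.
\<close>

definition inc :: "'i \<Rightarrow> ('i \<Rightarrow> nat) \<Rightarrow> 'i \<Rightarrow> nat" where
  "inc k n = n(k := Suc (n k))"

definition dec :: "'i \<Rightarrow> ('i \<Rightarrow> nat) \<Rightarrow> 'i \<Rightarrow> nat" where
  "dec k n = n(k := n k - 1)"

lemma inc_dec: "dec k (inc k n) = n" "n k \<noteq> 0 \<Longrightarrow> inc k (dec k n) = n"
  "j \<noteq> k \<Longrightarrow> dec k (inc j n) = inc j (dec k n)"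
  by (auto simp: inc_def dec_def)

lemma inc_apply: "inc k n k = Suc (n k)" "j \<noteq> k \<Longrightarrow> inc j n k = n k"
  by (simp_all add: inc_def)

lemma dec_apply: "dec k n k = n k - 1"
  by (simp add: dec_def)

lemma sum_inc: "sum (inc k n) UNIV = Suc (sum n UNIV)"
  by (subst (1 2) sum.remove[of _ k]) (auto simp: inc_def intro!: sum.cong)

lemma root_sum_inc: "root_sum (inc k n) = root_sum n + \<alpha> k"
proof -
  have "inc k n = (\<lambda>i. n i + (if i = k then 1 else 0))" by (auto simp: inc_def)
  then show ?thesis using root_sum_add[of n "\<lambda>i. if i = k then 1 else 0"] root_sum_single[of k 1]
    by simp
qed

lemma root_sum_inject: "root_sum n = root_sum m \<longleftrightarrow> n = m"
proof
  assume "root_sum n = root_sum m"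
  then have "(\<Sum>i\<in>UNIV. (real (n i) - real (m i)) *\<^sub>R \<alpha> i) = 0"
    by (simp add: root_sum_def scaleR_diff_left sum_subtractf)
  then show "n = m" using real_combination_roots_eq_0 by (fastforce intro!: ext)
qed simp

lemma root_sum_eq_0: "root_sum n = 0 \<longleftrightarrow> n = (\<lambda>_. 0)"
  using root_sum_inject[of n "\<lambda>_. 0"] by (simp add: root_sum_0)

lemma sum_less_if_root_sum_diff:
  assumes "root_sum n' = root_sum n - real m *\<^sub>R \<alpha> k" "0 < m"
  shows "sum n' UNIV < sum n UNIV"
proof -
  have "root_sum (\<lambda>i. n' i + (if i = k then m else 0)) = root_sum n"
    using assms(1) by (simp add: root_sum_add root_sum_single)
  then have "n = (\<lambda>i. n' i + (if i = k then m else 0))" by (simp add: root_sum_inject)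
  then show ?thesis using assms(2) by (simp add: sum.distrib)
qed

end

text \<open>
  The commutator \<open>[e, f]\<close> acts on \<open>f\<close> applied \<open>i\<close> times to \<open>v\<close> as \<open>m - 2 i\<close>. Hence \<open>e\<close> brings the
  next power back with the factor \<open>(i + 1) (m - i)\<close>, and the first power of \<open>f\<close> that kills \<open>v\<close>
  forces such a factor to vanish.
\<close>

lemma sl2_string:
  fixes sv :: "complex \<Rightarrow> 'v::ab_group_add \<Rightarrow> 'v" and e f :: "'v \<Rightarrow> 'v" and m :: complex
  assumes sv: "vector_space sv"
    and e0: "e v = 0"
    and comm: "\<And>i. e ((f ^^ Suc i) v) = f (e ((f ^^ i) v)) + sv (m - 2 * of_nat i) ((f ^^ i) v)"
    and f: "f 0 = 0" "\<And>c i. f (sv c ((f ^^ i) v)) = sv c ((f ^^ Suc i) v)"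
    and v: "v \<noteq> 0" and nil: "(f ^^ n) v = 0"
    and e: "e 0 = 0"
  obtains N where "m = of_nat N" "\<And>i. i \<le> N \<Longrightarrow> (f ^^ i) v \<noteq> 0"
proof -
  interpret vector_space sv by fact
  have step: "e ((f ^^ Suc i) v) = sv (of_nat (Suc i) * (m - of_nat i)) ((f ^^ i) v)" for i
  proof (induction i)
    case 0
    then show ?case using comm[of 0] by (simp add: e0 f)
  next
    case (Suc i)
    have "e ((f ^^ Suc (Suc i)) v) = sv (of_nat (Suc i) * (m - of_nat i)) ((f ^^ Suc i) v)
        + sv (m - 2 * of_nat (Suc i)) ((f ^^ Suc i) v)"
      using comm[of "Suc i"] unfolding Suc.IH f(2) .
    also have "\<dots> = sv (of_nat (Suc (Suc i)) * (m - of_nat (Suc i))) ((f ^^ Suc i) v)"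
      by (simp only: scale_left_distrib[symmetric]) (simp add: algebra_simps)
    finally show ?case .
  qed
  define p where "p = (LEAST n. (f ^^ n) v = 0)"
  have p: "(f ^^ p) v = 0" unfolding p_def using nil by (rule LeastI)
  have "p \<noteq> 0" using p v by (cases p) auto
  then obtain N where N: "p = Suc N" by (cases p) auto
  have nz: "(f ^^ i) v \<noteq> 0" if "i \<le> N" for i
    using not_less_Least[of i "\<lambda>n. (f ^^ n) v = 0"] that N by (auto simp: p_def)
  have "sv (of_nat (Suc N) * (m - of_nat N)) ((f ^^ N) v) = 0"
    using step[of N] p N e by simp
  then have "of_nat (Suc N) * (m - of_nat N) = 0" using nz[of N] by (simp only: scale_eq_0_iff) simp
  then have "m = of_nat N" by (simp del: of_nat_Suc)
  then show thesis using nz that by blast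
qed

locale km_module = km_algebra G + vs: vector_space sv
  for G :: "('g::ab_group_add, 'n::finite, 'i::finite) kac_moody_data"
    and sv :: "complex \<Rightarrow> 'v::ab_group_add \<Rightarrow> 'v" +
  fixes V :: "'v set" and act :: "'g \<Rightarrow> 'v \<Rightarrow> 'v"
  assumes g_module: "g_module G sv V act"
begin

abbreviation E :: "'i \<Rightarrow> 'v \<Rightarrow> 'v" where "E k \<equiv> act (chev_e G k)"
abbreviation F :: "'i \<Rightarrow> 'v \<Rightarrow> 'v" where "F k \<equiv> act (chev_f G k)"
abbreviation H :: "complex ^ 'n \<Rightarrow> 'v \<Rightarrow> 'v" where "H h \<equiv> act (cartan G h)"
abbreviation wt :: "complex ^ 'n \<Rightarrow> 'v set" where "wt \<equiv> weight_space G sv V act"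

lemma subspace_V: "vs.subspace V"
  using g_module by (simp add: g_module_def)

lemma act_closed: "v \<in> V \<Longrightarrow> act x v \<in> V"
  using g_module by (simp add: g_module_def)

lemma act_add: "u \<in> V \<Longrightarrow> v \<in> V \<Longrightarrow> act x (u + v) = act x u + act x v"
  using g_module by (simp add: g_module_def)

lemma act_scale: "v \<in> V \<Longrightarrow> act x (sv c v) = sv c (act x v)"
  using g_module by (simp add: g_module_def)

lemma act_add_left: "v \<in> V \<Longrightarrow> act (x + y) v = act x v + act y v"
  using g_module by (simp add: g_module_def)

lemma act_lscale: "v \<in> V \<Longrightarrow> act (lscale G c x) v = sv c (act x v)"
  using g_module by (simp add: g_module_def)

lemma act_bracket: "v \<in> V \<Longrightarrow> act (bracket G x y) v = act x (act y v) - act y (act x v)"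
  using g_module by (simp add: g_module_def)

lemma zero_in_V: "0 \<in> V"
  by (rule vs.subspace_0[OF subspace_V])

lemma act_0: "act x 0 = 0"
  using act_scale[OF zero_in_V, of x 0] by simp

lemma act_0_left: "v \<in> V \<Longrightarrow> act 0 v = 0"
proof -
  assume v: "v \<in> V"
  interpret g: vector_space "lscale G"
    using km by (simp add: kac_moody_algebra_def lie_algebra_def)
  show ?thesis using act_lscale[OF v, of 0 0] by simp
qed

lemma funpow_act_closed: "v \<in> V \<Longrightarrow> (act x ^^ n) v \<in> V"
  by (induction n) (auto intro: act_closed)

lemma funpow_act_0: "(act x ^^ n) 0 = 0"
  by (induction n) (auto simp: act_0)

lemma funpow_act_add: "u \<in> V \<Longrightarrow> v \<in> V \<Longrightarrow> (act x ^^ n) (u + v) = (act x ^^ n) u + (act x ^^ n) v"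
  by (induction n) (auto simp: act_add funpow_act_closed)

lemma funpow_act_scale: "v \<in> V \<Longrightarrow> (act x ^^ n) (sv c v) = sv c ((act x ^^ n) v)"
  by (induction n) (auto simp: act_scale funpow_act_closed)

lemma funpow_act_0_mono: "(act x ^^ a) v = 0 \<Longrightarrow> a \<le> b \<Longrightarrow> (act x ^^ b) v = 0"
  using funpow_add[of "b - a" a "act x"] by (simp add: funpow_act_0)

lemma act_span:
  assumes "S \<subseteq> V" "vs.subspace U" "\<And>u. u \<in> S \<Longrightarrow> act x u \<in> U" "y \<in> vs.span S"
  shows "act x y \<in> U"
proof -
  have "vs.subspace {y \<in> V. act x y \<in> U}"
    using subspace_V assms(2) by (auto simp: vs.subspace_def act_0 act_add act_scale)
  then have "vs.span S \<subseteq> {y \<in> V. act x y \<in> U}" using assms by (intro vs.span_minimal) auto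
  then show ?thesis using assms(4) by auto
qed

text \<open>
  By the Leibniz rule each application of \<open>y\<close> falls on \<open>x\<close> or on \<open>u\<close>. After \<open>a + b\<close> of them
  either \<open>x\<close> has been hit \<open>a\<close> times or \<open>u\<close> has been hit \<open>b\<close> times.
\<close>

lemma funpow_act_act_eq_0:
  assumes "(bracket G y ^^ a) x = 0" "u \<in> V" "(act y ^^ b) u = 0"
  shows "(act y ^^ (a + b)) (act x u) = 0"
  using assms
proof (induction "a + b" arbitrary: a b x u)
  case 0
  then show ?case by (simp add: act_0)
next
  case (Suc n)
  show ?case
  proof (cases "a = 0 \<or> b = 0")
    case True
    then have "act x u = 0" using Suc.prems by (auto simp: act_0 act_0_left)
    then show ?thesis by (simp add: funpow_act_0)
  next
    case False
    then obtain a' b' where ab: "a = Suc a'" "b = Suc b'" by (metis not0_implies_Suc)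
    have "(act y ^^ n) (act (bracket G y x) u) = 0"
      using Suc.hyps(1)[of a' b "bracket G y x" u] Suc.prems Suc.hyps(2) ab
      by (simp add: funpow_swap1)
    moreover have "(act y ^^ n) (act x (act y u)) = 0"
      using Suc.hyps(1)[of a b' x "act y u"] Suc.prems Suc.hyps(2) ab
      by (simp add: funpow_swap1 act_closed)
    moreover have "act y (act x u) = act (bracket G y x) u + act x (act y u)"
      using act_bracket[OF Suc.prems(2)] by simp
    ultimately have "(act y ^^ n) (act y (act x u)) = 0"
      using Suc.prems(2) by (simp add: funpow_act_add act_closed)
    then show ?thesis using Suc.hyps(2)[symmetric] by (simp add: funpow_swap1)
  qed
qed

lemma wtD: "v \<in> wt \<mu> \<Longrightarrow> v \<in> V" "v \<in> wt \<mu> \<Longrightarrow> H h v = sv (scalar_product h \<mu>) v"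
  by (auto simp: weight_space_def)

lemma subspace_wt: "vs.subspace (wt \<mu>)"
  using subspace_V by (auto simp: vs.subspace_def weight_space_def act_0 act_add act_scale
    vs.scale_right_distrib mult.commute)

lemma wt_unique: "v \<in> wt \<mu> \<Longrightarrow> v \<in> wt \<mu>' \<Longrightarrow> v \<noteq> 0 \<Longrightarrow> \<mu> = \<mu>'"
proof -
  assume v: "v \<in> wt \<mu>" "v \<in> wt \<mu>'" "v \<noteq> 0"
  have "scalar_product h \<mu> = scalar_product h \<mu>'" for h
    using wtD(2)[OF v(1), of h] wtD(2)[OF v(2), of h] v(3) by simp
  from this[of "axis _ 1"] show "\<mu> = \<mu>'"
    by (simp add: vec_eq_iff scalar_product_def axis_def if_distrib if_distribR cong: if_cong)
qed

lemma E_wt: "v \<in> wt \<mu> \<Longrightarrow> E k v \<in> wt (\<mu> + \<alpha> k)"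
proof -
  assume v: "v \<in> wt \<mu>"
  have "H h (E k v) = sv (scalar_product h (\<mu> + \<alpha> k)) (E k v)" for h
  proof -
    have "H h (E k v) = act (bracket G (cartan G h) (chev_e G k)) v + E k (H h v)"
      using act_bracket[OF wtD(1)[OF v]] by simp
    also have "bracket G (cartan G h) (chev_e G k) = lscale G (scalar_product h (\<alpha> k)) (chev_e G k)"
      using km by (simp add: kac_moody_algebra_def)
    finally show ?thesis
      using v by (simp add: wtD act_lscale act_scale scalar_product_simps vs.scale_left_distrib)
  qed
  then show ?thesis using v by (simp add: weight_space_def act_closed)
qed

lemma F_wt: "v \<in> wt \<mu> \<Longrightarrow> F k v \<in> wt (\<mu> - \<alpha> k)"
proof -
  assume v: "v \<in> wt \<mu>"
  have "H h (F k v) = sv (scalar_product h (\<mu> - \<alpha> k)) (F k v)" for h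
  proof -
    have "H h (F k v) = act (bracket G (cartan G h) (chev_f G k)) v + F k (H h v)"
      using act_bracket[OF wtD(1)[OF v]] by simp
    also have "bracket G (cartan G h) (chev_f G k) = lscale G (- scalar_product h (\<alpha> k)) (chev_f G k)"
      using km by (simp add: kac_moody_algebra_def)
    finally show ?thesis
      using v by (simp add: wtD act_lscale act_scale scalar_product_simps vs.scale_left_diff_distrib)
  qed
  then show ?thesis using v by (simp add: weight_space_def act_closed)
qed

lemma funpow_E_wt: "v \<in> wt \<mu> \<Longrightarrow> (E k ^^ n) v \<in> wt (\<mu> + real n *\<^sub>R \<alpha> k)"
  by (induction n) (auto simp: algebra_simps dest: E_wt[of _ _ k])

lemma funpow_F_wt: "v \<in> wt \<mu> \<Longrightarrow> (F k ^^ n) v \<in> wt (\<mu> - real n *\<^sub>R \<alpha> k)"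
  by (induction n) (auto simp: algebra_simps dest: F_wt[of _ _ k])

lemma E_F: "v \<in> V \<Longrightarrow> E k (F j v) = F j (E k v) + (if k = j then H (coroot G k) v else 0)"
proof -
  assume v: "v \<in> V"
  have "bracket G (chev_e G k) (chev_f G j) = (if k = j then cartan G (coroot G k) else 0)"
    using km by (simp add: kac_moody_algebra_def)
  then show ?thesis using act_bracket[OF v, of "chev_e G k" "chev_f G j"] act_0_left[OF v]
    by (auto simp: algebra_simps split: if_splits)
qed

lemma singular_string:
  assumes v: "v \<in> wt \<mu>" "v \<noteq> 0" "E k v = 0" "(F k ^^ n) v = 0"
  obtains N where "pr k \<mu> = of_nat N" "\<And>i. i \<le> N \<Longrightarrow> (F k ^^ i) v \<noteq> 0"
proof (rule sl2_string[of sv "E k" v "F k" "pr k \<mu>" n])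
  fix i
  have w: "(F k ^^ i) v \<in> wt (\<mu> - real i *\<^sub>R \<alpha> k)" by (rule funpow_F_wt[OF v(1)])
  then show "E k ((F k ^^ Suc i) v) = F k (E k ((F k ^^ i) v)) + sv (pr k \<mu> - 2 * of_nat i) ((F k ^^ i) v)"
    using E_F[OF wtD(1)[OF w], of k k] wtD(2)[OF w, of "coroot G k"]
    by (simp add: scalar_product_simps pr_root_self mult.commute)
  show "F k (sv c ((F k ^^ i) v)) = sv c ((F k ^^ Suc i) v)" for c
    using w by (simp add: act_scale wtD)
qed (use v in \<open>auto simp: act_0 vs.vector_space_axioms\<close>)

lemma cosingular_string:
  assumes v: "v \<in> wt \<mu>" "v \<noteq> 0" "F k v = 0" "(E k ^^ n) v = 0"
  obtains N where "pr k \<mu> = - of_nat N" "\<And>i. i \<le> N \<Longrightarrow> (E k ^^ i) v \<noteq> 0"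
proof (rule sl2_string[of sv "F k" v "E k" "- pr k \<mu>" n])
  fix i
  have w: "(E k ^^ i) v \<in> wt (\<mu> + real i *\<^sub>R \<alpha> k)" by (rule funpow_E_wt[OF v(1)])
  have "sv (- pr k \<mu> - 2 * of_nat i) ((E k ^^ i) v) = - sv (pr k (\<mu> + real i *\<^sub>R \<alpha> k)) ((E k ^^ i) v)"
    by (simp add: scalar_product_simps pr_root_self mult.commute flip: vs.scale_minus_left)
  then show "F k ((E k ^^ Suc i) v) = E k (F k ((E k ^^ i) v)) + sv (- pr k \<mu> - 2 * of_nat i) ((E k ^^ i) v)"
    using E_F[OF wtD(1)[OF w], of k k] wtD(2)[OF w, of "coroot G k"] by simp
  show "E k (sv c ((E k ^^ i) v)) = sv c ((E k ^^ Suc i) v)" for c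
    using w by (simp add: act_scale wtD)
  fix N assume "- pr k \<mu> = of_nat N" "\<And>i. i \<le> N \<Longrightarrow> (E k ^^ i) v \<noteq> 0"
  then show thesis by (intro that[of N]) (auto simp: minus_equation_iff)
qed (use v in \<open>auto simp: act_0 vs.vector_space_axioms\<close>)

text \<open>
  Weights are taken of arbitrary sets of vectors, since they are immediate on sets of homogeneous
  vectors, such as the set \<open>lowered\<close> below.
\<close>

definition wts :: "'v set \<Rightarrow> (complex ^ 'n) set" where
  "wts M = {\<mu>. \<exists>v\<in>M. v \<noteq> 0 \<and> v \<in> wt \<mu>}"

definition integrable_at :: "'i \<Rightarrow> 'v set \<Rightarrow> bool" where
  "integrable_at k M \<longleftrightarrow> (\<forall>v\<in>M. E k v \<in> M \<and> F k v \<in> M \<and>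
     (\<exists>n. (E k ^^ n) v = 0) \<and> (\<exists>n. (F k ^^ n) v = 0))"

lemma last_nonzero_power:
  fixes v :: 'v
  assumes "v \<noteq> 0" "(f ^^ n) v = 0"
  obtains p where "(f ^^ p) v \<noteq> 0" "f ((f ^^ p) v) = 0"
proof -
  define q where "q = (LEAST n. (f ^^ n) v = 0)"
  have q: "(f ^^ q) v = 0" unfolding q_def using assms(2) by (rule LeastI)
  have "q \<noteq> 0" using q assms(1) by (cases q) auto
  then obtain p where p: "q = Suc p" by (cases q) auto
  have "(f ^^ p) v \<noteq> 0" using not_less_Least[of p "\<lambda>n. (f ^^ n) v = 0"] p by (simp add: q_def)
  then show thesis using q p that by simp
qed

text \<open>
  Raise a weight vector as far as possible, or lower it as far as possible. The end of the string is
  a singular vector, and the string through it is long enough to reach the reflected weight: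
  from the top if the pairing is nonnegative, from the bottom otherwise.
\<close>

lemma wts_simple_reflection:
  assumes M: "integrable_at k M" and \<mu>: "\<mu> \<in> wts M"
  obtains m :: int where "pr k \<mu> = of_int m" "\<sigma> k \<mu> \<in> wts M"
proof -
  obtain v where v: "v \<in> M" "v \<noteq> 0" "v \<in> wt \<mu>" using \<mu> by (auto simp: wts_def)
  have EM: "(E k ^^ i) x \<in> M" if "x \<in> M" for i x
    using that M by (induction i) (auto simp: integrable_at_def)
  have FM: "(F k ^^ i) x \<in> M" if "x \<in> M" for i x
    using that M by (induction i) (auto simp: integrable_at_def)
  obtain p where p: "(E k ^^ p) v \<noteq> 0" "E k ((E k ^^ p) v) = 0"
    using last_nonzero_power[OF v(2)] M v(1) by (metis integrable_at_def)
  obtain q where q: "(F k ^^ q) v \<noteq> 0" "F k ((F k ^^ q) v) = 0"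
    using last_nonzero_power[OF v(2)] M v(1) by (metis integrable_at_def)
  obtain n n' where n: "(F k ^^ n) ((E k ^^ p) v) = 0" and n': "(E k ^^ n') ((F k ^^ q) v) = 0"
    using M EM[OF v(1)] FM[OF v(1)] unfolding integrable_at_def by metis
  obtain a where a: "pr k (\<mu> + real p *\<^sub>R \<alpha> k) = of_nat a" "\<And>i. i \<le> a \<Longrightarrow> (F k ^^ i) ((E k ^^ p) v) \<noteq> 0"
    using singular_string[OF funpow_E_wt[OF v(3)] p n] by blast
  obtain b where b: "pr k (\<mu> - real q *\<^sub>R \<alpha> k) = - of_nat b" "\<And>i. i \<le> b \<Longrightarrow> (E k ^^ i) ((F k ^^ q) v) \<noteq> 0"
    using cosingular_string[OF funpow_F_wt[OF v(3)] q n'] by blast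
  define m where "m = int a - 2 * int p"
  have m: "pr k \<mu> = of_int m"
    using a(1) by (simp add: m_def scalar_product_simps pr_root_self algebra_simps)
  have "(of_int m :: complex) = of_int (2 * int q - int b)"
    using b(1) by (simp add: m[symmetric] scalar_product_simps pr_root_self algebra_simps)
  then have mb: "m = 2 * int q - int b" by (simp only: of_int_eq_iff)
  have s: "\<sigma> k \<mu> = \<mu> - real_of_int m *\<^sub>R \<alpha> k" using m by (intro simple_reflection_of_real) simp
  have "\<sigma> k \<mu> \<in> wts M"
  proof (cases "0 \<le> m")
    case True
    \<comment> \<open>Lowering the top vector \<open>a - p\<close> times leads from \<open>\<mu> + p \<alpha>\<close> to \<open>\<mu> - m \<alpha>\<close>, as \<open>m = a - 2 p\<close>.\<close>
    define i where "i = a - p"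
    have i: "i \<le> a" "real i = m + p" using True by (auto simp: i_def m_def of_nat_diff)
    have "(F k ^^ i) ((E k ^^ p) v) \<in> wt (\<mu> + real p *\<^sub>R \<alpha> k - real i *\<^sub>R \<alpha> k)"
      by (rule funpow_F_wt[OF funpow_E_wt[OF v(3)]])
    also have "\<mu> + real p *\<^sub>R \<alpha> k - real i *\<^sub>R \<alpha> k = \<sigma> k \<mu>"
      unfolding s i(2) by (simp add: algebra_simps)
    finally show ?thesis using a(2)[OF i(1)] FM[OF EM[OF v(1)]] by (auto simp: wts_def)
  next
    case False
    \<comment> \<open>Raising the bottom vector \<open>q - m\<close> times leads from \<open>\<mu> - q \<alpha>\<close> to \<open>\<mu> - m \<alpha>\<close>; here \<open>q - m \<le> b\<close>,
      as \<open>b = 2 q - m\<close>.\<close>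
    define i where "i = nat (int q - m)"
    have i: "i \<le> b" "real i = q - m" using False mb by (auto simp: i_def)
    have "(E k ^^ i) ((F k ^^ q) v) \<in> wt (\<mu> - real q *\<^sub>R \<alpha> k + real i *\<^sub>R \<alpha> k)"
      by (rule funpow_E_wt[OF funpow_F_wt[OF v(3)]])
    also have "\<mu> - real q *\<^sub>R \<alpha> k + real i *\<^sub>R \<alpha> k = \<sigma> k \<mu>"
      unfolding s i(2) by (simp add: algebra_simps)
    finally show ?thesis using b(2)[OF i(1)] EM[OF FM[OF v(1)]] by (auto simp: wts_def)
  qed
  then show thesis using m that by blast
qed

lemma reflection_closed_wts:
  "(\<And>k. k \<in> J \<Longrightarrow> integrable_at k M) \<Longrightarrow> reflection_closed J (wts M)"
  unfolding reflection_closed_def using wts_simple_reflection by metis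

section \<open>Lowering a singular vector\<close>

text \<open>
  The coefficient function counts the uses of each lowering operator and so determines the weight
  of the result.
\<close>

inductive word :: "'i set \<Rightarrow> 'v \<Rightarrow> ('i \<Rightarrow> nat) \<Rightarrow> 'v \<Rightarrow> bool" for J v where
  empty: "word J v (\<lambda>_. 0) v"
| snoc: "word J v n u \<Longrightarrow> k \<in> J \<Longrightarrow> word J v (inc k n) (F k u)"

definition graded :: "'i set \<Rightarrow> 'v \<Rightarrow> ('i \<Rightarrow> nat) \<Rightarrow> 'v set" where
  "graded J v n = vs.span {u. word J v n u}"

text \<open>
  The homogeneous vectors of the module below \<open>v\<close>: a vector of weight \<open>\<mu>\<close> in this set lies in a
  graded piece, whose index gives \<open>\<mu>\<close> at once.
\<close>

definition lowered :: "'i set \<Rightarrow> 'v \<Rightarrow> 'v set" where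
  "lowered J v = (\<Union>n. graded J v n)"

lemma word_wt: "word J v n u \<Longrightarrow> v \<in> wt \<nu> \<Longrightarrow> u \<in> wt (\<nu> - root_sum n)"
proof (induction rule: word.induct)
  case empty
  then show ?case by (simp add: root_sum_0)
next
  case (snoc n u k)
  then show ?case using F_wt[of u "\<nu> - root_sum n" k] by (simp add: root_sum_inc diff_diff_eq)
qed

lemma word_in_graded: "word J v n u \<Longrightarrow> u \<in> graded J v n"
  by (simp add: graded_def vs.span_base)

lemma graded_wt: "v \<in> wt \<nu> \<Longrightarrow> graded J v n \<subseteq> wt (\<nu> - root_sum n)"
  unfolding graded_def by (intro vs.span_minimal subspace_wt) (auto intro: word_wt)

lemma words_subset_V: "v \<in> wt \<nu> \<Longrightarrow> {u. word J v n u} \<subseteq> V"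
  using word_wt wtD(1) by blast

lemma subspace_graded: "vs.subspace (graded J v n)"
  by (simp add: graded_def)

lemma F_graded:
  assumes "v \<in> wt \<nu>" "k \<in> J" "x \<in> graded J v n"
  shows "F k x \<in> graded J v (inc k n)"
  using assms(3) unfolding graded_def[of J v n]
  by (rule act_span[OF words_subset_V[OF assms(1)] subspace_graded, rotated])
    (auto intro: word_in_graded word.snoc assms(2))

text \<open>
  A raising operator that kills \<open>v\<close> commutes past the lowering operators with other indices, and
  past the one with the same index up to a scalar on the homogeneous vector behind it.
\<close>

lemma E_word:
  assumes v: "v \<in> wt \<nu>" "E k v = 0" and u: "word J v n u"
  shows "(n k = 0 \<longrightarrow> E k u = 0) \<and> E k u \<in> graded J v (dec k n)"
  using u
proof (induction rule: word.induct)
  case empty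
  then show ?case using v(2) vs.subspace_0[OF subspace_graded] by simp
next
  case (snoc n u j)
  have uV: "u \<in> V" and uw: "u \<in> wt (\<nu> - root_sum n)" using word_wt[OF snoc(1) v(1)] wtD(1) by auto
  show ?case
  proof (cases "k = j")
    case True
    have "F k (E k u) \<in> graded J v n"
    proof (cases "n k = 0")
      case True
      then show ?thesis using snoc by (simp add: act_0 vs.subspace_0[OF subspace_graded])
    next
      case False
      then show ?thesis
        using F_graded[OF v(1), of k J "E k u" "dec k n"] snoc \<open>k = j\<close> by (simp add: inc_dec)
    qed
    moreover have "H (coroot G k) u \<in> graded J v n"
      unfolding wtD(2)[OF uw] by (intro vs.subspace_scale[OF subspace_graded] word_in_graded snoc(1))
    ultimately show ?thesis
      using E_F[OF uV, of k j] True vs.subspace_add[OF subspace_graded] by (simp add: inc_dec inc_apply)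
  next
    case False
    then have eq: "E k (F j u) = F j (E k u)" using E_F[OF uV, of k j] by simp
    have "F j (E k u) \<in> graded J v (inc j (dec k n))"
      using F_graded[OF v(1) snoc(2), of "E k u" "dec k n"] snoc(3) by simp
    then show ?thesis using eq snoc(3) False by (simp add: act_0 inc_apply inc_dec)
  qed
qed

lemma E_graded:
  assumes v: "v \<in> wt \<nu>" "E k v = 0" and x: "x \<in> graded J v n"
  shows "E k x \<in> graded J v (dec k n)" "n k = 0 \<Longrightarrow> E k x = 0"
proof -
  show "E k x \<in> graded J v (dec k n)"
    using x unfolding graded_def[of J v n]
    by (rule act_span[OF words_subset_V[OF v(1)] subspace_graded, rotated])
      (use E_word[OF v] in auto)
  have "E k x \<in> {0}" if "n k = 0"
    using x unfolding graded_def[of J v n]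
    by (rule act_span[OF words_subset_V[OF v(1)] vs.subspace_single_0, rotated])
      (use E_word[OF v] that in auto)
  then show "n k = 0 \<Longrightarrow> E k x = 0" by simp
qed

lemma funpow_E_graded:
  assumes v: "v \<in> wt \<nu>" "E k v = 0"
  shows "x \<in> graded J v n \<Longrightarrow> (E k ^^ Suc (n k)) x = 0"
proof (induction "n k" arbitrary: n x)
  case 0
  then show ?case using E_graded(2)[OF v 0(2)] by simp
next
  case (Suc a)
  have "a = dec k n k" using Suc(2) by (simp add: dec_apply)
  from Suc(1)[OF this E_graded(1)[OF v Suc(3)]] have "(E k ^^ Suc a) (E k x) = 0"
    using \<open>a = dec k n k\<close> by simp
  then show ?case using Suc(2)[symmetric] by (simp add: funpow_swap1)
qed

lemma integrable_at_lowered: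
  assumes v: "v \<in> wt \<nu>" "E k v = 0" and k: "k \<in> J"
    and nil: "\<And>x. x \<in> V \<Longrightarrow> \<exists>n. (F k ^^ n) x = 0"
  shows "integrable_at k (lowered J v)"
  unfolding integrable_at_def lowered_def
proof (intro ballI)
  fix x assume "x \<in> (\<Union>n. graded J v n)"
  then obtain n where x: "x \<in> graded J v n" by blast
  then have "x \<in> V" using graded_wt[OF v(1)] wtD(1) by blast
  then obtain m where "(F k ^^ m) x = 0" using nil by blast
  then show "E k x \<in> (\<Union>n. graded J v n) \<and> F k x \<in> (\<Union>n. graded J v n) \<and>
     (\<exists>n. (E k ^^ n) x = 0) \<and> (\<exists>n. (F k ^^ n) x = 0)"
    using E_graded(1)[OF v x] F_graded[OF v(1) k x] funpow_E_graded[OF v x]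
    by (intro conjI UN_I[OF UNIV_I] exI)
qed

lemma wts_lowered:
  assumes v: "v \<in> wt \<nu>" and \<mu>: "\<mu> \<in> wts (lowered J v)"
  obtains n u where "\<mu> = \<nu> - root_sum n" "word J v n u" "u \<noteq> 0"
proof -
  obtain x n where x: "x \<noteq> 0" "x \<in> wt \<mu>" "x \<in> graded J v n" using \<mu> by (auto simp: wts_def lowered_def)
  have "\<mu> = \<nu> - root_sum n" by (rule wt_unique[OF x(2) subsetD[OF graded_wt[OF v] x(3)] x(1)])
  moreover obtain u where "word J v n u" "u \<noteq> 0"
  proof (rule ccontr)
    assume "\<not> thesis"
    then have "{u. word J v n u} \<subseteq> {0}" using that by blast
    then have "graded J v n \<subseteq> {0}" unfolding graded_def by (intro vs.span_minimal vs.subspace_single_0)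
    then show False using x by auto
  qed
  ultimately show thesis by (rule that)
qed

lemma word_in_wts: "v \<in> wt \<nu> \<Longrightarrow> word J v n u \<Longrightarrow> u \<noteq> 0 \<Longrightarrow> \<nu> - root_sum n \<in> wts (lowered J v)"
  using word_wt[of J v n u \<nu>] word_in_graded[of J v n u] by (auto simp: wts_def lowered_def)

text \<open>
  All weights of \<open>lowered J v\<close> are \<open>\<nu>\<close> minus sums of simple roots, so this bounds the orbit
  of \<open>\<nu>\<close> from above.
\<close>

lemma orbit_lowered:
  assumes v: "v \<in> wt \<nu>" "v \<noteq> 0" and E: "\<And>k. k \<in> J \<Longrightarrow> E k v = 0"
    and nil: "\<And>k x. k \<in> J \<Longrightarrow> x \<in> V \<Longrightarrow> \<exists>n. (F k ^^ n) x = 0"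
  shows "orbit J \<nu> \<subseteq> wts (lowered J v)" "reflection_closed J (wts (lowered J v))"
proof -
  show r: "reflection_closed J (wts (lowered J v))"
    using integrable_at_lowered[OF v(1) E _ nil] by (intro reflection_closed_wts)
  have "\<nu> \<in> wts (lowered J v)" using word_in_wts[OF v(1) word.empty v(2)] by (simp add: root_sum_0)
  then show "orbit J \<nu> \<subseteq> wts (lowered J v)"
    using reflection_closed_weyl_group[OF r] by (auto simp: orbit_def)
qed

text \<open>
  Let \<open>x\<close> be in the orbit of \<open>\<nu>\<close>. If some coroot in \<open>J\<close> is negative on \<open>x\<close>, its reflection
  moves \<open>x\<close> up, and induction on the height of \<open>\<nu> - x\<close> applies. It remains to see that a dominant
  \<open>x = w \<nu>\<close> equals \<open>\<nu>\<close>. No \<open>x + \<alpha> k\<close> is a weight of the module below \<open>v\<close>: by invariance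
  \<open>x - (m + 1) \<alpha> k\<close> with \<open>m \<ge> 0\<close> would be one as well, and carrying both back with the
  inverse of \<open>w\<close> would put the image of \<open>\<alpha> k\<close> both into the positive root cone and into its
  negative. So a vector of weight \<open>x\<close> is itself singular. The module below this vector has
  all its weights below \<open>x\<close>, but the whole orbit among its weights, hence \<open>\<nu> \<le> x \<le> \<nu>\<close>.
\<close>

lemma descending_highest_weight:
  assumes v: "v \<in> wt \<nu>" "v \<noteq> 0" and E: "\<And>k. k \<in> J \<Longrightarrow> E k v = 0"
    and nil: "\<And>k x. k \<in> J \<Longrightarrow> x \<in> V \<Longrightarrow> \<exists>n. (F k ^^ n) x = 0"
  shows "descending J \<nu>"
proof -
  let ?M = "lowered J v"
  note orb = orbit_lowered[OF v E nil]
  have int: "integrable_at k ?M" if "k \<in> J" for k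
    by (rule integrable_at_lowered[OF v(1) E[OF that] that nil[OF that]])
  have top: "x = \<nu>" if x: "x \<in> orbit J \<nu>" and dom: "\<And>k. k \<in> J \<Longrightarrow> \<exists>m::nat. pr k x = of_nat m" for x
  proof -
    obtain w where w: "w \<in> W J" "x = w \<nu>" using x by (auto simp: orbit_def)
    obtain w' where w': "w' \<in> W J" "\<And>y. w' (w y) = y" using weyl_group_inverse[OF w(1)] by metis
    have w'x: "w' x = \<nu>" by (simp add: w w')
    note lin = linear_weyl_group[OF w'(1)]
    have below: "\<exists>n. w' y = \<nu> - root_sum n" if "y \<in> wts ?M" for y
      using reflection_closed_weyl_group[OF orb(2) w'(1) that] wts_lowered[OF v(1)] by metis
    have "x \<in> wts ?M" using orb(1) x by blast
    then obtain y where y: "y \<in> ?M" "y \<noteq> 0" "y \<in> wt x" by (auto simp: wts_def)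
    have "E k y = 0" if k: "k \<in> J" for k
    proof (rule ccontr)
      assume "E k y \<noteq> 0"
      then have 1: "x + \<alpha> k \<in> wts ?M"
        using E_wt[OF y(3)] int[OF k] y(1) by (auto simp: wts_def integrable_at_def)
      obtain m :: nat where m: "pr k x = of_nat m" using dom[OF k] by blast
      have "\<sigma> k (x + \<alpha> k) = x + \<alpha> k - (real m + 2) *\<^sub>R \<alpha> k"
        using m by (intro simple_reflection_of_real) (simp add: scalar_product_simps pr_root_self)
      also have "\<dots> = x - (real m + 1) *\<^sub>R \<alpha> k" by (simp add: scaleR_left_distrib scaleR_2)
      finally have 2: "x - (real m + 1) *\<^sub>R \<alpha> k \<in> wts ?M"
        using orb(2) 1 k by (metis reflection_closed_def)
      \<comment> \<open>Carried back by \<open>w'\<close>, the two weights say that \<open>w' (\<alpha> k)\<close> is minus a sum of simple roots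
        and that a positive multiple of it is a sum of simple roots.\<close>
      obtain a where a: "\<nu> + w' (\<alpha> k) = \<nu> - root_sum a"
        using below[OF 1] by (auto simp: linear_add[OF lin] w'x)
      obtain b where b: "\<nu> - (real m + 1) *\<^sub>R w' (\<alpha> k) = \<nu> - root_sum b"
        using below[OF 2] by (auto simp: linear_diff[OF lin] linear_scale[OF lin] w'x)
      have "w' (\<alpha> k) = - root_sum a" using a by (metis add_left_cancel diff_conv_add_uminus)
      moreover have "(real m + 1) *\<^sub>R w' (\<alpha> k) = root_sum b" using b by simp
      ultimately have "root_sum b = - (real (m + 1) *\<^sub>R root_sum a)" by (simp add: add.commute)
      then have "root_sum b + real (m + 1) *\<^sub>R root_sum a = 0" by simp
      then have "root_sum (\<lambda>i. b i + (m + 1) * a i) = 0" by (simp only: root_sum_add root_sum_mult)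
      then have "a = (\<lambda>_. 0)" by (auto simp: root_sum_eq_0 fun_eq_iff)
      then have "w' (\<alpha> k) = 0" using a by (simp add: root_sum_0)
      moreover obtain w'' where "\<And>z. w'' (w' z) = z" "w'' \<in> W J" using weyl_group_inverse[OF w'(1)] by metis
      ultimately have "\<alpha> k = 0" using linear_0[OF linear_weyl_group] by metis
      then show False using root_ne_0 by simp
    qed
    \<comment> \<open>So \<open>y\<close> is singular; the module below it has all weights below \<open>x\<close>, and \<open>\<nu>\<close> is one of them.\<close>
    then have "orbit J x \<subseteq> wts (lowered J y)" using orbit_lowered(1)[OF y(3,2) _ nil] by blast
    then have "\<nu> \<in> wts (lowered J y)" using orbitI[OF w'(1), of x] w'x by auto
    then obtain a where a: "\<nu> = x - root_sum a" using wts_lowered[OF y(3)] by metis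
    obtain b where b: "x = \<nu> - root_sum b" using wts_lowered[OF v(1) \<open>x \<in> wts ?M\<close>] by metis
    have "root_sum a = x - \<nu>" "root_sum b = \<nu> - x"
      by (subst a, simp) (subst b, simp)
    then have "root_sum (\<lambda>i. a i + b i) = 0" by (simp add: root_sum_add)
    then have "b = (\<lambda>_. 0)" by (auto simp: root_sum_eq_0 fun_eq_iff)
    then show "x = \<nu>" using b by (simp add: root_sum_0)
  qed
  have "\<nu> - root_sum n \<in> descents J \<nu>" if "\<nu> - root_sum n \<in> orbit J \<nu>" for n
    using that
  proof (induction "sum n UNIV" arbitrary: n rule: less_induct)
    case less
    let ?x = "\<nu> - root_sum n"
    have xM: "?x \<in> wts ?M" using orb(1) less(2) by blast
    have "\<exists>m::int. pr k ?x = of_int m" if "k \<in> J" for k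
      using wts_simple_reflection[OF int[OF that] xM] by blast
    show ?case
    proof (cases "\<exists>k\<in>J. \<exists>m::int. pr k ?x = of_int m \<and> m < 0")
      case True
      then obtain k and m :: int where k: "k \<in> J" "pr k ?x = of_int m" "m < 0" by blast
      have s: "\<sigma> k ?x = ?x - real_of_int m *\<^sub>R \<alpha> k" using k by (intro simple_reflection_of_real) simp
      have so: "\<sigma> k ?x \<in> orbit J \<nu>" using reflection_closed_orbit less(2) k(1) by (simp add: reflection_closed_def)
      then obtain n' where n': "\<sigma> k ?x = \<nu> - root_sum n'" using orb(1) wts_lowered[OF v(1)] by (metis subsetD)
      have "root_sum n' = root_sum n - real (nat (- m)) *\<^sub>R \<alpha> k"
        using s n' k(3) by (simp add: algebra_simps)
      then have "sum n' UNIV < sum n UNIV" using k(3) by (intro sum_less_if_root_sum_diff[of n' n "nat (- m)" k]) auto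
      then have "\<sigma> k ?x \<in> descents J \<nu>" using less(1) so n' by metis
      moreover have "pr k (\<sigma> k ?x) \<in> \<real>\<^sub>\<ge>\<^sub>0"
        using k(3) by (simp add: pr_simple_reflection k(2) complex_nonneg_Reals_iff)
      ultimately have "\<sigma> k (\<sigma> k ?x) \<in> descents J \<nu>" by (rule descents.step[OF _ k(1)])
      then show ?thesis by (simp add: simple_reflection_involutive)
    next
      case False
      have "\<exists>m::nat. pr k ?x = of_nat m" if k: "k \<in> J" for k
      proof -
        obtain m :: int where m: "pr k ?x = of_int m" using wts_simple_reflection[OF int[OF k] xM] .
        then have "\<not> m < 0" using False k by blast
        then have "0 \<le> m" by simp
        then show ?thesis using m by (metis of_int_of_nat_eq zero_le_imp_eq_int)
      qed
      then have "?x = \<nu>" by (rule top[OF less(2)])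
      then show ?thesis using descents.start[of \<nu> J] by simp
    qed
  qed
  moreover have "\<exists>n. x = \<nu> - root_sum n" if "x \<in> orbit J \<nu>" for x
    using wts_lowered[OF v(1) subsetD[OF orb(1) that]] by metis
  ultimately show ?thesis unfolding descending_def by blast
qed

lemma dominant_highest_weight:
  assumes v: "v \<in> wt \<nu>" "v \<noteq> 0" and E: "\<And>k. k \<in> J \<Longrightarrow> E k v = 0"
    and nil: "\<And>k x. k \<in> J \<Longrightarrow> x \<in> V \<Longrightarrow> \<exists>n. (F k ^^ n) x = 0"
  shows "\<nu> \<in> dominant G J"
  unfolding dominant_def
proof (intro CollectI ballI)
  fix k assume k: "k \<in> J"
  obtain n where "(F k ^^ n) v = 0" using nil[OF k wtD(1)[OF v(1)]] by blast
  then obtain N where "pr k \<nu> = of_nat N" using singular_string[OF v E[OF k]] by blast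
  then show "pr k \<nu> \<in> \<real>\<^sub>\<ge>\<^sub>0" by simp
qed

text \<open>
  Compositions of operators \<open>H h - c\<close>. They act on weight vectors by scalars and commute with each
  other, and serve to kill all weight components of a vector except one.
\<close>

fun shifts :: "((complex ^ 'n) \<times> complex) list \<Rightarrow> 'v \<Rightarrow> 'v" where
  "shifts [] y = y"
| "shifts ((h, c) # hs) y = (let z = shifts hs y in H h z - sv c z)"

lemma H_commute: "y \<in> V \<Longrightarrow> H h (H h' y) = H h' (H h y)"
  using act_bracket[of y "cartan G h" "cartan G h'"] km act_0_left[of y]
  by (simp add: kac_moody_algebra_def)

lemma act_diff: "y \<in> V \<Longrightarrow> z \<in> V \<Longrightarrow> act x (y - z) = act x y - act x z"
  using act_add[of "y - z" z x] vs.subspace_diff[OF subspace_V] by (simp add: algebra_simps)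

lemma shifts_closed: "y \<in> V \<Longrightarrow> shifts hs y \<in> V"
  by (induction hs y rule: shifts.induct)
    (auto simp: Let_def intro!: vs.subspace_diff[OF subspace_V] vs.subspace_scale[OF subspace_V] act_closed)

lemma shifts_add: "y \<in> V \<Longrightarrow> z \<in> V \<Longrightarrow> shifts hs (y + z) = shifts hs y + shifts hs z"
  by (induction hs) (auto simp: Let_def act_add shifts_closed vs.scale_right_distrib)

lemma shifts_scale: "y \<in> V \<Longrightarrow> shifts hs (sv a y) = sv a (shifts hs y)"
  by (induction hs) (auto simp: Let_def act_scale shifts_closed vs.scale_right_diff_distrib mult.commute)

lemma shifts_0: "shifts hs 0 = 0"
  by (induction hs) (auto simp: Let_def act_0)

lemma shifts_step_commute: "y \<in> V \<Longrightarrow> shifts hs (H h y - sv c y) = H h (shifts hs y) - sv c (shifts hs y)"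
proof (induction hs)
  case (Cons p hs)
  obtain h' c' where p: "p = (h', c')" by (cases p)
  define z where "z = shifts hs y"
  have z: "z \<in> V" "shifts hs (H h y - sv c y) = H h z - sv c z"
    using Cons by (auto simp: z_def shifts_closed)
  show ?case unfolding p shifts.simps Let_def z(2) z_def[symmetric] using z(1)
    by (simp add: act_diff act_closed act_scale vs.subspace_scale[OF subspace_V] H_commute[of _ h h']
      vs.scale_right_diff_distrib mult.commute)
qed simp

lemma shifts_append: "y \<in> V \<Longrightarrow> shifts (as @ bs) y = shifts bs (shifts as y)"
  by (induction as) (auto simp: Let_def shifts_step_commute shifts_closed)

lemma shifts_append': "shifts (as @ bs) y = shifts as (shifts bs y)"
  by (induction as) (auto simp: Let_def)

lemma shifts_wt:
  assumes "y \<in> wt \<mu>"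
  shows "shifts hs y = sv (\<Prod>(h, c)\<leftarrow>hs. scalar_product h \<mu> - c) y"
proof (induction hs)
  case (Cons p hs)
  then show ?case using assms
    by (cases p) (simp add: Let_def act_scale wtD vs.scale_left_diff_distrib algebra_simps)
qed simp

text \<open>
  Otherwise every element of \<open>S\<close>, hence every element of its span, is killed by some composition
  of shifts \<open>H h - c\<close> with \<open>c\<close> different from the value of \<open>\<mu>\<close> at \<open>h\<close>; but such compositions
  are injective on vectors of weight \<open>\<mu>\<close>.
\<close>

lemma wt_of_span:
  assumes S: "S \<subseteq> (\<Union>\<mu>. wt \<mu>)" and x: "x \<in> vs.span S" "x \<in> wt \<mu>" "x \<noteq> 0"
  obtains b where "b \<in> S" "b \<noteq> 0" "b \<in> wt \<mu>"
proof (rule ccontr)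
  assume "\<not> thesis"
  then have none: "\<forall>b\<in>S. b \<in> wt \<mu> \<longrightarrow> b = 0" using that by blast
  define U where "U = {y \<in> V. \<exists>hs. (\<forall>(h, c)\<in>set hs. scalar_product h \<mu> \<noteq> c) \<and> shifts hs y = 0}"
  have "S \<subseteq> U"
  proof
    fix b assume b: "b \<in> S"
    then obtain \<mu>' where \<mu>': "b \<in> wt \<mu>'" using S by blast
    show "b \<in> U"
    proof (cases "\<mu>' = \<mu>")
      case True
      then show ?thesis using none b \<mu>' zero_in_V by (auto simp: U_def intro!: exI[of _ "[]"])
    next
      case False
      then obtain i where "\<mu>' $ i \<noteq> \<mu> $ i" by (auto simp: vec_eq_iff)
      then have "scalar_product (axis i 1) \<mu> \<noteq> scalar_product (axis i 1) \<mu>'"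
        by (simp add: scalar_product_def axis_def if_distrib if_distribR cong: if_cong)
      moreover have "shifts [(axis i 1, scalar_product (axis i 1) \<mu>')] b = 0"
        using wtD(2)[OF \<mu>'] by simp
      ultimately show ?thesis using wtD(1)[OF \<mu>'] unfolding U_def
        by (intro CollectI conjI exI[of _ "[(axis i 1, scalar_product (axis i 1) \<mu>')]"]) auto
    qed
  qed
  moreover have "vs.subspace U"
  proof (rule vs.subspaceI)
    show "0 \<in> U" using zero_in_V by (auto simp: U_def intro!: exI[of _ "[]"])
    fix y z c assume y: "y \<in> U"
    then obtain as where as: "\<forall>(h, c)\<in>set as. scalar_product h \<mu> \<noteq> c" "shifts as y = 0" "y \<in> V" by (auto simp: U_def)
    then show "sv c y \<in> U" using vs.subspace_scale[OF subspace_V]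
      by (auto simp: U_def shifts_scale intro!: exI[of _ as])
    assume "z \<in> U"
    then obtain bs where bs: "\<forall>(h, c)\<in>set bs. scalar_product h \<mu> \<noteq> c" "shifts bs z = 0" "z \<in> V" by (auto simp: U_def)
    have "shifts (as @ bs) (y + z) = shifts bs (shifts as y) + shifts as (shifts bs z)"
      using as bs by (simp add: shifts_add shifts_append' shifts_append[symmetric] shifts_0)
    then have "shifts (as @ bs) (y + z) = 0" using as bs by (simp add: shifts_0)
    then show "y + z \<in> U" using as bs vs.subspace_add[OF subspace_V] unfolding U_def
      by (intro CollectI conjI exI[of _ "as @ bs"]) auto
  qed
  ultimately have "x \<in> U" using vs.span_minimal x(1) by blast
  then obtain hs where hs: "\<forall>(h, c)\<in>set hs. scalar_product h \<mu> \<noteq> c" "shifts hs x = 0" by (auto simp: U_def)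
  have "(\<Prod>(h, c)\<leftarrow>hs. scalar_product h \<mu> - c) \<noteq> 0" using hs(1) by (induction hs) auto
  then show False using shifts_wt[OF x(2), of hs] hs(2) x(3) by simp
qed

end

section \<open>The adjoint module and highest weight modules\<close>

context km_algebra begin

lemma lie_algebra: "lie_algebra (lscale G) (bracket G)"
  using km by (simp add: kac_moody_algebra_def)

lemma bracket_linear:
  "module_hom (lscale G) (lscale G) (bracket G x)"
  "module_hom (lscale G) (lscale G) (\<lambda>x. bracket G x y)"
  using lie_algebra by (auto simp: lie_algebra_def linear_iff_module_hom)

lemma bracket_self: "bracket G x x = 0"
  using lie_algebra by (simp add: lie_algebra_def)

lemma bracket_antisym: "bracket G x y = - bracket G y x"
proof -
  have "bracket G (x + y) (x + y) = bracket G y x + bracket G x y"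
    by (simp only: module_hom.add[OF bracket_linear(1)] module_hom.add[OF bracket_linear(2)]
      bracket_self[of x] bracket_self[of y] add_0_left add_0_right)
  then have "bracket G y x + bracket G x y = 0" by (simp only: bracket_self)
  then show ?thesis by (metis neg_eq_iff_add_eq_0)
qed

lemma adjoint: "km_module G (lscale G) UNIV (bracket G)"
proof -
  interpret vs: vector_space "lscale G" using lie_algebra by (simp add: lie_algebra_def)
  note lin = bracket_linear
  have "bracket G (bracket G x y) v = bracket G x (bracket G y v) - bracket G y (bracket G x v)" for x y v
  proof -
    have "bracket G x (bracket G y v) + bracket G y (bracket G v x) + bracket G v (bracket G x y) = 0"
      using lie_algebra by (simp add: lie_algebra_def)
    moreover have "bracket G y (bracket G v x) = - bracket G y (bracket G x v)"
      using module_hom.neg[OF lin(1)] bracket_antisym[of v x] by simp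
    moreover have "bracket G v (bracket G x y) = - bracket G (bracket G x y) v" by (rule bracket_antisym)
    ultimately show ?thesis by (simp add: algebra_simps)
  qed
  then have "g_module G (lscale G) UNIV (bracket G)"
    by (simp add: g_module_def lin[THEN module_hom.add] lin[THEN module_hom.scale])
  then show ?thesis by unfold_locales
qed

lemma generated:
  assumes "module.subspace (lscale G) U" "\<And>x y. x \<in> U \<Longrightarrow> y \<in> U \<Longrightarrow> bracket G x y \<in> U"
    "\<And>h. cartan G h \<in> U" "\<And>i. chev_e G i \<in> U" "\<And>i. chev_f G i \<in> U"
  shows "x \<in> U"
proof -
  have "module.subspace (lscale G) U \<and> (\<forall>x\<in>U. \<forall>y\<in>U. bracket G x y \<in> U) \<and>
      range (cartan G) \<union> range (chev_e G) \<union> range (chev_f G) \<subseteq> U \<longrightarrow> U = UNIV"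
    using km unfolding kac_moody_algebra_def by (elim conjE) (erule spec)
  then have "U = UNIV" using assms by auto
  then show ?thesis by simp
qed

text \<open>
  By the Leibniz rule the elements killed by some power of a given inner derivation form a
  subalgebra.
\<close>

lemma ad_nilpotent_if_on_generators:
  assumes "\<And>h. \<exists>n. (bracket G y ^^ n) (cartan G h) = 0"
    "\<And>i. \<exists>n. (bracket G y ^^ n) (chev_e G i) = 0" "\<And>i. \<exists>n. (bracket G y ^^ n) (chev_f G i) = 0"
  shows "\<exists>n. (bracket G y ^^ n) x = 0"
proof -
  interpret ad: km_module G "lscale G" UNIV "bracket G" by (rule adjoint)
  have "x \<in> {x. \<exists>n. (bracket G y ^^ n) x = 0}"
  proof (rule generated)
    show "ad.vs.subspace {x. \<exists>n. (bracket G y ^^ n) x = 0}"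
    proof (rule ad.vs.subspaceI)
      fix p q assume "p \<in> {x. \<exists>n. (bracket G y ^^ n) x = 0}" "q \<in> {x. \<exists>n. (bracket G y ^^ n) x = 0}"
      then obtain a b where "(bracket G y ^^ a) p = 0" "(bracket G y ^^ b) q = 0" by blast
      then have "(bracket G y ^^ (max a b)) p = 0" "(bracket G y ^^ (max a b)) q = 0"
        by (auto elim: ad.funpow_act_0_mono)
      then have "(bracket G y ^^ (max a b)) (p + q) = 0" by (simp add: ad.funpow_act_add)
      then show "p + q \<in> {x. \<exists>n. (bracket G y ^^ n) x = 0}" by blast
    qed (auto simp: ad.funpow_act_0 ad.funpow_act_scale)
    show "bracket G p q \<in> {x. \<exists>n. (bracket G y ^^ n) x = 0}"
      if "p \<in> {x. \<exists>n. (bracket G y ^^ n) x = 0}" "q \<in> {x. \<exists>n. (bracket G y ^^ n) x = 0}" for p q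
      using that ad.funpow_act_act_eq_0 by blast
  qed (use assms in auto)
  then show ?thesis by simp
qed

text \<open>
  On the Cartan subalgebra and the raising generators the iterates of the lowering generator vanish
  after at most three steps; on the lowering generators this is the Serre relation.
\<close>

lemma ad_nilpotent_f: "\<exists>n. (bracket G (chev_f G k) ^^ n) x = 0"
proof (rule ad_nilpotent_if_on_generators)
  interpret ad: km_module G "lscale G" UNIV "bracket G" by (rule adjoint)
  have fh: "(bracket G (chev_f G k) ^^ 2) (cartan G h) = 0" for h
  proof -
    have "bracket G (chev_f G k) (cartan G h) = lscale G (scalar_product h (\<alpha> k)) (chev_f G k)"
      using km bracket_antisym[of "chev_f G k"] by (simp add: kac_moody_algebra_def)
    moreover have "bracket G (chev_f G k) (chev_f G k) = 0"
      using km by (simp add: kac_moody_algebra_def lie_algebra_def)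
    ultimately show ?thesis by (simp add: numeral_2_eq_2 ad.act_scale)
  qed
  then show "\<exists>n. (bracket G (chev_f G k) ^^ n) (cartan G h) = 0" for h by blast
  show "\<exists>n. (bracket G (chev_f G k) ^^ n) (chev_e G i) = 0" for i
  proof -
    have "bracket G (chev_f G k) (chev_e G i) = - (if i = k then cartan G (coroot G i) else 0)"
      using km bracket_antisym[of "chev_f G k"] by (simp add: kac_moody_algebra_def)
    then have "bracket G (chev_f G k) (chev_e G i) = lscale G (- 1) (if i = k then cartan G (coroot G i) else 0)"
      by simp
    then have "(bracket G (chev_f G k) ^^ Suc 2) (chev_e G i) = 0"
      unfolding funpow_Suc_right comp_def using fh by (simp add: ad.funpow_act_scale ad.funpow_act_0 del: ad.vs.scale_minus_left)
    then show ?thesis by blast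
  qed
  show "\<exists>n. (bracket G (chev_f G k) ^^ n) (chev_f G i) = 0" for i
  proof (cases "i = k")
    case True
    then have "(bracket G (chev_f G k) ^^ 1) (chev_f G i) = 0"
      using km by (simp add: kac_moody_algebra_def lie_algebra_def)
    then show ?thesis by blast
  next
    case False
    then show ?thesis using km unfolding kac_moody_algebra_def by metis
  qed
qed

lemma chev_f_ne_0: "chev_f G k \<noteq> 0"
proof
  interpret ad: km_module G "lscale G" UNIV "bracket G" by (rule adjoint)
  assume "chev_f G k = 0"
  then have "cartan G (coroot G k) = 0"
    using km ad.act_0[of "chev_e G k"] by (simp add: kac_moody_algebra_def) metis
  moreover have "cartan G 0 = 0"
    using km module_hom.zero[of "(*s)" "lscale G" "cartan G"]
    by (simp add: kac_moody_algebra_def linear_iff_module_hom)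
  ultimately have "coroot G k = 0" using km by (metis kac_moody_algebra_def injD)
  then show False using pr_root_self[of k] by (simp add: scalar_product_def)
qed

text \<open>
  In the adjoint module the lowering generator of \<open>j\<close> is a vector of weight \<open>- \<alpha> j\<close> that is killed
  by the raising generators in \<open>J\<close>, as \<open>j\<close> is not in \<open>J\<close>.
\<close>

lemma descending_minus_root:
  assumes "j \<notin> J"
  shows "descending J (- \<alpha> j)"
proof -
  interpret ad: km_module G "lscale G" UNIV "bracket G" by (rule adjoint)
  show ?thesis
  proof (rule ad.descending_highest_weight)
    show "chev_f G j \<in> ad.wt (- \<alpha> j)"
      using km by (simp add: weight_space_def kac_moody_algebra_def scalar_product_simps)
    show "bracket G (chev_e G k) (chev_f G j) = 0" if "k \<in> J" for k
      using km that assms by (auto simp: kac_moody_algebra_def)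
  qed (use chev_f_ne_0 ad_nilpotent_f in auto)
qed

end

context km_module begin

text \<open>
  Hence a lowering operator is locally nilpotent on a highest weight module as soon as some power
  of it kills the highest weight vector.
\<close>

lemma funpow_F_nilpotent_submodule:
  "g_module G sv {x \<in> V. \<exists>n. (F k ^^ n) x = 0} act"
proof -
  let ?U = "{x \<in> V. \<exists>n. (F k ^^ n) x = 0}"
  have "vs.subspace ?U"
  proof (rule vs.subspaceI)
    show "0 \<in> ?U" using zero_in_V funpow_act_0 by blast
    fix p q c assume "p \<in> ?U"
    then obtain a where p: "p \<in> V" "(F k ^^ a) p = 0" by blast
    then show "sv c p \<in> ?U"
      using vs.subspace_scale[OF subspace_V] by (auto simp: funpow_act_scale intro!: exI[of _ a])
    assume "q \<in> ?U"
    then obtain b where q: "q \<in> V" "(F k ^^ b) q = 0" by blast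
    have "(F k ^^ (max a b)) p = 0" "(F k ^^ (max a b)) q = 0"
      using p q by (auto elim: funpow_act_0_mono)
    then have "(F k ^^ (max a b)) (p + q) = 0" using p q by (simp add: funpow_act_add)
    then show "p + q \<in> ?U" using p q vs.subspace_add[OF subspace_V] by blast
  qed
  moreover have "act x u \<in> ?U" if "u \<in> ?U" for x u
  proof -
    obtain a where "(bracket G (chev_f G k) ^^ a) x = 0" using ad_nilpotent_f by blast
    then show ?thesis using that funpow_act_act_eq_0 act_closed by blast
  qed
  ultimately show ?thesis
    unfolding g_module_def
    by (auto simp: act_add act_scale act_add_left act_lscale act_bracket)
qed

lemma span_words_submodule:
  assumes v: "v \<in> wt \<nu>" and E: "\<And>i. E i v = 0"
  shows "g_module G sv (vs.span {u. \<exists>n. word UNIV v n u}) act"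
proof -
  let ?B = "{u. \<exists>n. word UNIV v n u}"
  let ?U = "vs.span ?B"
  have BV: "?B \<subseteq> V" using words_subset_V[OF v] by blast
  have UV: "?U \<subseteq> V" by (rule vs.span_minimal[OF BV subspace_V])
  have gU: "graded UNIV v n \<subseteq> ?U" for n unfolding graded_def by (intro vs.span_mono) blast
  have "x \<in> {x. \<forall>u\<in>?U. act x u \<in> ?U}" for x
  proof (rule generated)
    interpret g: vector_space "lscale G"
      using km by (simp add: kac_moody_algebra_def lie_algebra_def)
    show "g.subspace {x. \<forall>u\<in>?U. act x u \<in> ?U}"
      using UV by (intro g.subspaceI)
        (auto simp: act_0_left act_add_left act_lscale subset_iff intro: vs.span_zero vs.span_add vs.span_scale)
    show "bracket G x y \<in> {x. \<forall>u\<in>?U. act x u \<in> ?U}"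
      if "x \<in> {x. \<forall>u\<in>?U. act x u \<in> ?U}" "y \<in> {x. \<forall>u\<in>?U. act x u \<in> ?U}" for x y
      using that UV by (auto simp: act_bracket subset_iff intro: vs.span_diff)
    have gen: "x \<in> {x. \<forall>u\<in>?U. act x u \<in> ?U}" if "\<And>u. u \<in> ?B \<Longrightarrow> act x u \<in> ?U" for x
      using act_span[OF BV vs.subspace_span that] by blast
    show "cartan G h \<in> {x. \<forall>u\<in>?U. act x u \<in> ?U}" for h
    proof (rule gen)
      fix u assume u: "u \<in> ?B"
      then obtain n where "u \<in> wt (\<nu> - root_sum n)" using word_wt[OF _ v] by blast
      then show "H h u \<in> ?U" using u by (simp add: wtD vs.span_scale vs.span_base)
    qed
    show "chev_e G i \<in> {x. \<forall>u\<in>?U. act x u \<in> ?U}" for i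
    proof (rule gen)
      fix u assume "u \<in> ?B"
      then show "E i u \<in> ?U" using E_word[OF v E] gU by blast
    qed
    show "chev_f G i \<in> {x. \<forall>u\<in>?U. act x u \<in> ?U}" for i
    proof (rule gen)
      fix u assume "u \<in> ?B"
      then show "F i u \<in> ?U" using word.snoc[OF _ UNIV_I] by (blast intro: vs.span_base)
    qed
  qed
  then show ?thesis
    unfolding g_module_def using UV
    by (auto simp: act_add act_scale act_add_left act_lscale act_bracket subset_iff)
qed

text \<open>
  One inclusion: the weights contain the orbit of \<open>\<nu>\<close> and, for \<open>i\<close> outside \<open>J\<close>, all
  \<open>\<nu> - n \<alpha> i\<close>, because no power of the lowering operator kills the highest weight vector.
  For the other inclusion let \<open>x\<close> be a weight below \<open>\<nu>\<close> and choose \<open>j\<close> such that \<open>x + \<alpha> j\<close> is also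
  a weight, which is in the polyhedron by induction on the height. If \<open>j\<close> is outside \<open>J\<close>,
  the polyhedron absorbs \<open>- \<alpha> j\<close>. If \<open>j\<close> is in \<open>J\<close> and the pairing of \<open>x\<close> with the coroot is
  nonnegative, \<open>x\<close> is between \<open>x + \<alpha> j\<close> and its mirror image; if it is negative, the mirror image
  of \<open>x\<close> is a weight of smaller height.
\<close>

lemma convex_hull_weights:
  assumes hw: "v \<in> wt \<nu>" "v \<noteq> 0" "\<And>i. E i v = 0"
    and gen: "\<And>U. U \<subseteq> V \<Longrightarrow> g_module G sv U act \<Longrightarrow> v \<in> U \<Longrightarrow> U = V"
    and J: "integrability G V act = J"
  shows "convex hull (weights G sv V act) = ray_polyhedron J \<nu>" "\<nu> \<in> dominant G J" "descending J \<nu>"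
proof -
  have nil: "\<exists>n. (F k ^^ n) x = 0" if "k \<in> J" "x \<in> V" for k x
    using that J by (auto simp: integrability_def)
  show dom: "\<nu> \<in> dominant G J" and "descending J \<nu>"
    using dominant_highest_weight[OF hw(1,2)] descending_highest_weight[OF hw(1,2)] hw(3) nil by blast+
  let ?M = "lowered UNIV v" and ?wts = "weights G sv V act"
  have span: "vs.span {u. \<exists>n. word UNIV v n u} = V"
    using words_subset_V[OF hw(1)] word.empty
    by (intro gen span_words_submodule[OF hw(1,3)] vs.span_minimal subspace_V) (blast intro: vs.span_base)+
  have wts: "?wts = wts ?M"
  proof
    show "wts ?M \<subseteq> ?wts"
      by (auto simp: wts_def weights_def)
    show "?wts \<subseteq> wts ?M"
    proof
      fix \<mu> assume "\<mu> \<in> ?wts"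
      then obtain x where x: "x \<in> wt \<mu>" "x \<noteq> 0" by (auto simp: weights_def)
      have "{u. \<exists>n. word UNIV v n u} \<subseteq> (\<Union>\<mu>. wt \<mu>)" using word_wt[OF _ hw(1)] by blast
      moreover have "x \<in> vs.span {u. \<exists>n. word UNIV v n u}" using x wtD(1) span by blast
      ultimately obtain b n where "word UNIV v n b" "b \<noteq> 0" "b \<in> wt \<mu>" using wt_of_span x by blast
      then show "\<mu> \<in> wts ?M" using word_in_graded[of UNIV v n b] by (auto simp: wts_def lowered_def)
    qed
  qed
  have int: "integrable_at k ?M" if "k \<in> J" for k
    by (rule integrable_at_lowered[OF hw(1,3) UNIV_I nil[OF that]])
  have ref: "reflection_closed J (wts ?M)" using int by (rule reflection_closed_wts)
  have top: "\<nu> \<in> wts ?M" using word_in_wts[OF hw(1) word.empty hw(2)] by (simp add: root_sum_0)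
  have nonnil: "(F i ^^ n) v \<noteq> 0" if "i \<notin> J" for i n
  proof
    assume "(F i ^^ n) v = 0"
    then have "{x \<in> V. \<exists>n. (F i ^^ n) x = 0} = V"
      using wtD(1)[OF hw(1)] by (intro gen funpow_F_nilpotent_submodule) auto
    then have "i \<in> integrability G V act" unfolding integrability_def by blast
    then show False using that J by simp
  qed
  have "ray_polyhedron J \<nu> \<subseteq> convex hull (wts ?M)"
  proof (rule ray_polyhedron_subset[OF convex_convex_hull reflection_closed_convex_hull[OF ref] dom])
    show "\<nu> \<in> convex hull wts ?M" using top by (rule hull_inc)
    show "descending J (- \<alpha> i)" if "i \<notin> J" for i by (rule descending_minus_root[OF that])
    fix i and t :: real assume i: "i \<notin> J" and t: "0 \<le> t"
    obtain n :: nat where n: "t \<le> real n" using real_arch_simple by blast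
    have word: "word UNIV v (if_pow n) ((F i ^^ n) v)" if "if_pow = (\<lambda>n j. if j = i then n else (0::nat))" for if_pow n
    proof (induction n)
      case 0
      then show ?case using word.empty[of UNIV v] that by simp
    next
      case (Suc n)
      have "if_pow (Suc n) = inc i (if_pow n)" by (auto simp: that inc_def)
      then show ?case using word.snoc[OF Suc UNIV_I, of i] by simp
    qed
    have "\<nu> - real n *\<^sub>R \<alpha> i \<in> wts ?M"
      using word_in_wts[OF hw(1) word[OF refl] nonnil[OF i]] by (simp only: root_sum_single)
    then have "closed_segment \<nu> (\<nu> - real n *\<^sub>R \<alpha> i) \<subseteq> convex hull wts ?M"
      using top by (intro closed_segment_subset convex_convex_hull hull_inc)
    moreover have "\<nu> - t *\<^sub>R \<alpha> i \<in> closed_segment \<nu> (\<nu> - real n *\<^sub>R \<alpha> i)"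
    proof (cases "n = 0")
      case True
      then show ?thesis using n t by simp
    next
      case False
      then have "\<nu> - t *\<^sub>R \<alpha> i = (1 - t / n) *\<^sub>R \<nu> + (t / n) *\<^sub>R (\<nu> - real n *\<^sub>R \<alpha> i)"
        by (simp add: scaleR_diff_right scaleR_diff_left)
      moreover have "0 \<le> t / n" "t / n \<le> 1" using n t False by (auto simp: divide_simps)
      ultimately show ?thesis unfolding in_segment by blast
    qed
    ultimately show "\<nu> - t *\<^sub>R \<alpha> i \<in> convex hull wts ?M" by blast
  qed
  moreover have "wts ?M \<subseteq> ray_polyhedron J \<nu>"
  proof -
    let ?X = "ray_polyhedron J \<nu>"
    have "\<nu> - root_sum n \<in> ?X" if "\<nu> - root_sum n \<in> wts ?M" for n
      using that
    proof (induction "sum n UNIV" arbitrary: n rule: less_induct)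
      case less
      let ?x = "\<nu> - root_sum n"
      obtain n0 u where "?x = \<nu> - root_sum n0" "word UNIV v n0 u" "u \<noteq> 0"
        by (rule wts_lowered[OF hw(1) less(2)])
      then have "word UNIV v n u" "u \<noteq> 0" by (auto simp: root_sum_inject)
      then show ?case
      proof (cases rule: word.cases)
        case empty
        then show ?thesis using self_in_ray_polyhedron by (simp add: root_sum_0)
      next
        case (snoc n' u' j)
        have u': "u' \<noteq> 0" using snoc(2) \<open>u \<noteq> 0\<close> act_0 by auto
        have up: "\<nu> - root_sum n' \<in> ?X"
          using less(1)[of n'] word_in_wts[OF hw(1) snoc(3) u'] snoc(1) by (simp add: sum_inc)
        have x: "?x = \<nu> - root_sum n' - \<alpha> j" using snoc(1) by (simp add: root_sum_inc diff_diff_eq)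
        show ?thesis
        proof (cases "j \<in> J")
          case False
          then show ?thesis using ray_polyhedron_minus_root[OF up False, of 1] unfolding x by simp
        next
          case True
          obtain m :: int where m: "pr j ?x = of_int m" "\<sigma> j ?x \<in> wts ?M"
            using wts_simple_reflection[OF int[OF True] less(2)] .
          have ref: "\<sigma> j y \<in> ?X" if "y \<in> ?X" for y
            using reflection_closed_ray_polyhedron True that by (simp add: reflection_closed_def)
          show ?thesis
          proof (cases "m < 0")
            case True
            have s: "\<sigma> j ?x = ?x - real_of_int m *\<^sub>R \<alpha> j" using m by (intro simple_reflection_of_real) simp
            obtain n'' where n'': "\<sigma> j ?x = \<nu> - root_sum n''" using wts_lowered[OF hw(1) m(2)] by metis
            have "root_sum n'' = root_sum n - real (nat (- m)) *\<^sub>R \<alpha> j"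
              using s n'' True by (simp add: algebra_simps)
            then have "sum n'' UNIV < sum n UNIV"
              using True by (intro sum_less_if_root_sum_diff[of n'' n "nat (- m)" j]) auto
            then have "\<sigma> j ?x \<in> ?X" using less(1) m(2) n'' by metis
            then have "\<sigma> j (\<sigma> j ?x) \<in> ?X" by (rule ref)
            then show ?thesis by (simp add: simple_reflection_involutive)
          next
            case False
            define y where "y = \<nu> - root_sum n'"
            have y: "y \<in> ?X" "?x = y - \<alpha> j" using up x by (auto simp: y_def)
            have "pr j y = of_real (real_of_int m + 2)"
              using m(1) unfolding y(2) by (simp add: scalar_product_simps pr_root_self algebra_simps)
            then have s: "\<sigma> j y = y - (real_of_int m + 2) *\<^sub>R \<alpha> j" by (rule simple_reflection_of_real)
            \<comment> \<open>The mirror image of \<open>y\<close> is \<open>m + 2\<close> roots below \<open>y\<close>, and \<open>?x\<close> is one root below.\<close>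
            define c where "c = 1 / (real_of_int m + 2)"
            have c: "0 \<le> c" "c \<le> 1" "c * (real_of_int m + 2) = 1" using False by (auto simp: c_def)
            have "?x = (1 - c) *\<^sub>R y + c *\<^sub>R \<sigma> j y"
              unfolding s y(2) by (simp add: scaleR_diff_right scaleR_diff_left c(3))
            then have "?x \<in> closed_segment y (\<sigma> j y)" unfolding in_segment using c by blast
            then show ?thesis
              using closed_segment_subset[OF y(1) ref[OF y(1)] convex_ray_polyhedron] by blast
          qed
        qed
      qed
    qed
    then show ?thesis using wts_lowered[OF hw(1)] by (metis subsetI)
  qed
  then have "convex hull wts ?M \<subseteq> ray_polyhedron J \<nu>" using convex_ray_polyhedron by (rule hull_minimal)
  ultimately show "convex hull ?wts = ray_polyhedron J \<nu>" unfolding wts by blast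
qed

end

context km_algebra begin

lemma weyl_polyhedron_eq_P_polyhedron:
  assumes sv: "vector_space sv" and C: "weyl_polyhedron G sv J C"
  obtains \<nu> where "\<nu> \<in> dominant G J" "C = P_polyhedron G \<nu> J" "C \<noteq> {}"
proof -
  obtain N :: nat and t V act where t: "\<forall>m<N. 0 < t m" "(\<Sum>m<N. t m) = 1"
    and hw: "\<forall>m<N. highest_weight_module G sv (V m) (act m) \<and> integrability G (V m) (act m) = J"
    and C_eq: "C = {\<Sum>m<N. t m *\<^sub>R x m | x. \<forall>m<N. x m \<in> convex hull (weights G sv (V m) (act m))}"
    using C unfolding weyl_polyhedron_def by blast
  have "\<exists>\<nu>. m < N \<longrightarrow> convex hull (weights G sv (V m) (act m)) = ray_polyhedron J \<nu> \<and>
      \<nu> \<in> dominant G J \<and> descending J \<nu>" for m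
  proof (cases "m < N")
    case True
    then have m: "highest_weight_module G sv (V m) (act m)" "integrability G (V m) (act m) = J"
      using hw by auto
    then interpret km_module G sv "V m" "act m"
      using km sv by (simp add: km_module_def km_module_axioms_def km_algebra_def highest_weight_module_def)
    obtain \<nu> v where "v \<in> wt \<nu>" "v \<noteq> 0" "\<forall>i. E i v = 0"
      "\<forall>U\<subseteq>V m. g_module G sv U (act m) \<and> v \<in> U \<longrightarrow> U = V m"
      using m(1) unfolding highest_weight_module_def by blast
    then show ?thesis using convex_hull_weights[of v \<nu> J] m(2) by blast
  qed auto
  then obtain \<nu> where \<nu>: "\<And>m. m < N \<Longrightarrow> convex hull (weights G sv (V m) (act m)) = ray_polyhedron J (\<nu> m)"
    "\<And>m. m < N \<Longrightarrow> \<nu> m \<in> dominant G J" "\<And>m. m < N \<Longrightarrow> descending J (\<nu> m)" by metis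
  let ?\<nu> = "\<Sum>m<N. t m *\<^sub>R \<nu> m"
  have dom: "?\<nu> \<in> dominant G J" using t(1) \<nu>(2) by (intro dominant_sum) (simp add: less_imp_le)
  have "C = {\<Sum>m<N. t m *\<^sub>R x m | x. \<forall>m<N. x m \<in> ray_polyhedron J (\<nu> m)}"
    unfolding C_eq using \<nu>(1) by (simp cong: conj_cong imp_cong)
  also have "\<dots> = ray_polyhedron J ?\<nu>"
    using t \<nu> by (intro ray_polyhedron_sum) (auto simp: less_imp_le)
  finally have "C = ray_polyhedron J ?\<nu>" .
  moreover have "ray_polyhedron J ?\<nu> = P_polyhedron G ?\<nu> J"
    using P_polyhedron_eq_ray_polyhedron[OF dom descending_minus_root] by simp
  ultimately show thesis using dom self_in_ray_polyhedron that[OF dom] by auto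
qed

end

section \<open>The \<open>f\<close>-polynomial of a family of Weyl polyhedra\<close>

theorem proposition7p15:
  fixes G :: "('g::ab_group_add, 'n::finite, 'i::finite) kac_moody_data"
    and sv :: "complex \<Rightarrow> 'v::ab_group_add \<Rightarrow> 'v"
    and J :: "'i set"
    and S :: "'s::euclidean_space set"
    and P :: "('s \<times> (complex ^ 'n)) set"
  assumes "kac_moody_algebra G"
    and "vector_space sv"
    and "convex S"
    and "weyl_family G sv J S P"
  shows "\<exists>(lam :: 's \<Rightarrow> complex ^ 'n) (f :: 's set \<Rightarrow> enat poly).
     (\<forall>s\<in>S. lam s \<in> dominant G J \<and> fiber P s = P_polyhedron G (lam s) J) \<and>
     (\<forall>F\<in>faces S. \<forall>s\<in>rel_interior F. f F = f_poly (P_polyhedron G (lam s) J)) \<and>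
     (\<forall>k. coeff (f_poly P) k = (\<Sum>\<^sub>\<infinity>F\<in>faces S. coeff (monom 1 (face_dim F) * f F) k))"
proof -
  interpret km_algebra G using assms(1) by unfold_locales
  note fam = assms(4)[unfolded weyl_family_def]
  have "\<exists>\<nu>. \<nu> \<in> dominant G J \<and> fiber P s = P_polyhedron G \<nu> J" "fiber P s \<noteq> {}" if "s \<in> S" for s
    using weyl_polyhedron_eq_P_polyhedron[OF assms(2)] fam that by metis+
  then obtain lam where lam: "\<forall>s\<in>S. lam s \<in> dominant G J \<and> fiber P s = P_polyhedron G (lam s) J"
    and ne: "\<forall>s\<in>S. fiber P s \<noteq> {}" by metis
  have "fst ` P = S"
    using fam ne by (force simp: fiber_def)
  then have P: "convex_family S P"
    using fam by (simp add: convex_family_def)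
  define f where "f F = f_poly (fiber P (SOME s. s \<in> rel_interior F))" for F
  have some: "(SOME s. s \<in> rel_interior F) \<in> rel_interior F" if "F \<in> faces S" for F
    using that rel_interior_eq_empty[of F] face_of_imp_convex[of F S]
    by (auto simp: faces_def some_in_eq)
  have "f F = f_poly (P_polyhedron G (lam s) J)" if F: "F \<in> faces S" and s: "s \<in> rel_interior F" for F s
  proof -
    have "s \<in> S" using F s rel_interior_subset[of F] by (auto simp: faces_def dest: face_of_imp_subset)
    then show ?thesis using f_poly_fiber_eq[OF P F some[OF F] s] lam by (simp add: f_def)
  qed
  moreover have "coeff (f_poly P) k = (\<Sum>\<^sub>\<infinity>F\<in>faces S. coeff (monom 1 (face_dim F) * f F) k)" for k
    using some by (intro coeff_f_poly_convex_family[OF P]) (auto simp: f_def)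
  ultimately show ?thesis using lam by blast
qed

end
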